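(* Let $(X,\mathcal R)$ be a cometric Q-antipodal association scheme with $w$ fibres and Krein array $\{b_0^*,b_1^*,\dots,b_{d-1}^*;c_1^*,\dots,c_d^*\}$, where $d\ge3$, and let $\ell=\lceil d/2\rceil$. Then the dismantled scheme induced on a union $Y$ of $w'\ge2$ fibres is cometric Q-antipodal with Krein array $\{\overline b_0^*,\dots,\overline b_{d-1}^*;\overline c_1^*,\dots,\overline c_d^*\}$, where $\overline c_j^*=c_j^*$ for $j\ne\ell$, $\overline c_\ell^*=\frac{w}{w'}c_\ell^*$, $\overline b_j^*=b_j^*$ for $j\ne d-\ell$, and $\overline b_{d-\ell}^*=\frac{w}{w'}\cdot\frac{w'-1}{w-1}b_{d-\ell}^*$.
   Context: Symmetric $d$-class association scheme: relations $R_0,\dots,R_d$ partitioning $X\times X$, $R_0$ diagonal, all symmetric, constant intersection numbers; primitive idempotents $E_0=\frac1{|X|}J,\dots,E_d$; Krein parameters $q^h_{ij}$ via $E_i\circ E_j=\frac1{|X|}\sum_hq^h_{ij}E_h$. Cometric: an ordering $E_0,\dots,E_d$ with $q^h_{ij}=0$ if $h<|i-j|$ or $h>i+j$ and $q^{i+j}_{ij}>0$ for $i+j\le d$; Krein array with $b_i^*=q^i_{1,i+1}$, $c_i^*=q^i_{1,i-1}$. Q-antipodal: cometric and, in that ordering, $n(E_0+E_d)$ is the $0/1$ matrix of an equivalence relation with $w$ classes (fibres) of size $n$. For a union $Y$ of at least two fibres, the dismantled scheme on $Y$ has as relations the nonempty $R_i\cap(Y\times Y)$ (it is an association scheme). 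*)

theory Defs
  imports Complex_Main "HOL-Library.Disjoint_Sets"
begin

text \<open>Matrices with rows and columns indexed by a finite set \<open>X\<close> are functions
  \<open>'a \<Rightarrow> 'a \<Rightarrow> real\<close>; the ones considered below vanish outside \<open>X \<times> X\<close>, so equality of
  functions is equality of matrices. Real entries suffice: all relations are symmetric.\<close>

type_synonym 'a sqmat = "'a \<Rightarrow> 'a \<Rightarrow> real"

definition adj :: "('a \<times> 'a) set \<Rightarrow> 'a sqmat" where
  "adj R = (\<lambda>x y. of_bool ((x, y) \<in> R))"

definition mat_mult :: "'a set \<Rightarrow> 'a sqmat \<Rightarrow> 'a sqmat \<Rightarrow> 'a sqmat" where
  "mat_mult X A B = (\<lambda>x y. \<Sum>z\<in>X. A x z * B z y)"

definition mat_add :: "'a sqmat \<Rightarrow> 'a sqmat \<Rightarrow> 'a sqmat" where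
  "mat_add A B = (\<lambda>x y. A x y + B x y)"

definition mat_zero :: "'a sqmat" where
  "mat_zero = (\<lambda>x y. 0)"

definition schur :: "'a sqmat \<Rightarrow> 'a sqmat \<Rightarrow> 'a sqmat" where
  "schur A B = (\<lambda>x y. A x y * B x y)"

text \<open>Symmetric \<open>d\<close>-class scheme, given by its (unordered) set of \<open>d + 1\<close> relations.\<close>

definition association_scheme :: "'a set \<Rightarrow> nat \<Rightarrow> ('a \<times> 'a) set set \<Rightarrow> bool" where
  "association_scheme X d \<R> \<longleftrightarrow>
     finite X \<and> X \<noteq> {} \<and>
     partition_on (X \<times> X) \<R> \<and> card \<R> = Suc d \<and>
     Id_on X \<in> \<R> \<and> (\<forall>R\<in>\<R>. sym R) \<and>
     (\<forall>R\<in>\<R>. \<forall>S\<in>\<R>. \<forall>T\<in>\<R>. \<exists>p::nat. \<forall>(x, y)\<in>T.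
        card {z \<in> X. (x, z) \<in> R \<and> (z, y) \<in> S} = p)"

definition bose_mesner :: "('a \<times> 'a) set set \<Rightarrow> 'a sqmat set" where
  "bose_mesner \<R> = {(\<lambda>x y. \<Sum>R\<in>\<R>. c R * adj R x y) | c. True}"

definition idempotents :: "'a set \<Rightarrow> ('a \<times> 'a) set set \<Rightarrow> 'a sqmat set" where
  "idempotents X \<R> = {E \<in> bose_mesner \<R>. mat_mult X E E = E}"

definition primitive_idempotents :: "'a set \<Rightarrow> ('a \<times> 'a) set set \<Rightarrow> 'a sqmat set" where
  "primitive_idempotents X \<R> = {E \<in> idempotents X \<R>. E \<noteq> mat_zero \<and>
     (\<forall>F\<in>idempotents X \<R>. \<forall>G\<in>idempotents X \<R>.
        mat_mult X F G = mat_zero \<and> mat_mult X G F = mat_zero \<and> E = mat_add F G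
          \<longrightarrow> F = mat_zero \<or> G = mat_zero)}"

definition idempotent_ordering ::
  "'a set \<Rightarrow> nat \<Rightarrow> ('a \<times> 'a) set set \<Rightarrow> (nat \<Rightarrow> 'a sqmat) \<Rightarrow> bool" where
  "idempotent_ordering X d \<R> E \<longleftrightarrow>
     bij_betw E {0..d} (primitive_idempotents X \<R>) \<and>
     E 0 = (\<lambda>x y. 1 / real (card X) * adj (X \<times> X) x y)"

text \<open>\<open>krein X d E i j h\<close> is \<open>q\<^sup>h\<^sub>i\<^sub>j\<close>. For \<open>i, j \<le> d\<close> the coefficients exist and are unique, since
  the primitive idempotents form a basis of the Bose-Mesner algebra, which is closed under
  the entrywise product.\<close>

definition krein :: "'a set \<Rightarrow> nat \<Rightarrow> (nat \<Rightarrow> 'a sqmat) \<Rightarrow> nat \<Rightarrow> nat \<Rightarrow> nat \<Rightarrow> real" where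
  "krein X d E i j =
     (THE q. (\<forall>h>d. q h = 0) \<and>
        schur (E i) (E j) = (\<lambda>x y. 1 / real (card X) * (\<Sum>h=0..d. q h * E h x y)))"

definition cometric ::
  "'a set \<Rightarrow> nat \<Rightarrow> ('a \<times> 'a) set set \<Rightarrow> (nat \<Rightarrow> 'a sqmat) \<Rightarrow> bool" where
  "cometric X d \<R> E \<longleftrightarrow>
     association_scheme X d \<R> \<and> idempotent_ordering X d \<R> E \<and>
     (\<forall>i\<le>d. \<forall>j\<le>d. \<forall>h\<le>d.
        int h < \<bar>int i - int j\<bar> \<or> h > i + j \<longrightarrow> krein X d E i j h = 0) \<and>
     (\<forall>i j. i + j \<le> d \<longrightarrow> krein X d E i j (i + j) > 0)"

definition krein_array ::
  "'a set \<Rightarrow> nat \<Rightarrow> (nat \<Rightarrow> 'a sqmat) \<Rightarrow> (nat \<Rightarrow> real) \<Rightarrow> (nat \<Rightarrow> real) \<Rightarrow> bool" where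
  "krein_array X d E b c \<longleftrightarrow>
     (\<forall>i\<in>{0..<d}. b i = krein X d E 1 (i + 1) i) \<and>
     (\<forall>i\<in>{1..d}. c i = krein X d E 1 (i - 1) i)"

definition fibre_rel :: "'a set \<Rightarrow> nat \<Rightarrow> (nat \<Rightarrow> 'a sqmat) \<Rightarrow> ('a \<times> 'a) set" where
  "fibre_rel X d E = {(x, y) \<in> X \<times> X. E 0 x y + E d x y \<noteq> 0}"

definition fibres :: "'a set \<Rightarrow> nat \<Rightarrow> (nat \<Rightarrow> 'a sqmat) \<Rightarrow> 'a set set" where
  "fibres X d E = X // fibre_rel X d E"

text \<open>If \<open>n (E\<^sub>0 + E\<^sub>d)\<close> is the 0/1 matrix of a relation, \<open>n > 0\<close>, then that relation is
  the support of \<open>E\<^sub>0 + E\<^sub>d\<close>, that is, \<open>fibre_rel X d E\<close>.\<close>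

definition Q_antipodal ::
  "'a set \<Rightarrow> nat \<Rightarrow> ('a \<times> 'a) set set \<Rightarrow> (nat \<Rightarrow> 'a sqmat) \<Rightarrow> bool" where
  "Q_antipodal X d \<R> E \<longleftrightarrow>
     cometric X d \<R> E \<and> equiv X (fibre_rel X d E) \<and>
     (\<exists>n::nat. (\<forall>F\<in>fibres X d E. card F = n) \<and>
        (\<lambda>x y. real n * (E 0 x y + E d x y)) = adj (fibre_rel X d E))"

definition dismantled :: "('a \<times> 'a) set set \<Rightarrow> 'a set \<Rightarrow> ('a \<times> 'a) set set" where
  "dismantled \<R> Y = {R \<inter> (Y \<times> Y) | R. R \<in> \<R> \<and> R \<inter> (Y \<times> Y) \<noteq> {}}"

end

theory Submission
  imports Defs "HOL-Library.Function_Algebras"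
begin

text \<open>Let \<open>B = n (E\<^sub>0 + E\<^sub>d)\<close> be the fibre matrix. Since \<open>B \<circ> _\<close> is a self-adjoint idempotent map, the triangle
  conditions on the Krein parameters force \<open>B \<circ> E\<^sub>j = (E\<^sub>j + E\<^sub>d\<^sub>-\<^sub>j) / w\<close> for \<open>2 j < d\<close> and
  \<open>B \<circ> E\<^sub>j = E\<^sub>j\<close> for \<open>2 j = d\<close>. In particular \<open>E\<^sub>j + E\<^sub>d\<^sub>-\<^sub>j\<close> is block diagonal with respect to the
  fibres, and a trace computation yields \<open>E\<^sub>j P E\<^sub>j = E\<^sub>j / w\<close> for the coordinate projection \<open>P\<close> onto any
  single fibre. Hence on a union of \<open>w'\<close> fibres the restriction of \<open>E\<^sub>j\<close>, scaled by \<open>w / w'\<close>, and its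
  complement in the restriction of \<open>E\<^sub>j + E\<^sub>d\<^sub>-\<^sub>j\<close> are orthogonal idempotents. There are \<open>d + 1\<close> of
  them in the span of at most \<open>d + 1\<close> restricted relations, so they form a basis of that span, which is
  therefore closed under multiplication: the dismantled relations form a scheme. Its Krein parameters
  \<open>q\<^sup>h\<^sub>1\<^sub>j\<close> are read off by restricting the expansions of \<open>E\<^sub>1 \<circ> E\<^sub>j\<close>, and the remaining cometric
  conditions follow from the three-term recurrence.\<close>

section \<open>Bases of orthogonal idempotents\<close>

lemma mat_mult_assoc: "mat_mult X (mat_mult X L M) N = mat_mult X L (mat_mult X M N)"
  unfolding mat_mult_def sum_distrib_left sum_distrib_right by (intro ext, subst sum.swap) (simp add: mult_ac)

lemma mat_mult_diff_left:
  "mat_mult X (\<lambda>x y. M x y - N x y) L = (\<lambda>x y. mat_mult X M L x y - mat_mult X N L x y)"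
  and mat_mult_diff_right:
  "mat_mult X L (\<lambda>x y. M x y - N x y) = (\<lambda>x y. mat_mult X L M x y - mat_mult X L N x y)"
  by (simp_all add: mat_mult_def algebra_simps sum_subtractf)

lemma mat_mult_zero_right: "mat_mult X M mat_zero = mat_zero"
  by (simp add: mat_mult_def mat_zero_def)

text \<open>At a pair in \<open>R\<close> only the summand of \<open>R\<close> survives, by
  disjointness. The criterion lets membership in the span be checked entrywise, without naming
  coefficients.\<close>

lemma bose_mesner_iff:
  assumes part: "partition_on (X \<times> X) \<R>" and fin: "finite \<R>"
  shows "M \<in> bose_mesner \<R> \<longleftrightarrow>
    (\<forall>x y. (x, y) \<notin> X \<times> X \<longrightarrow> M x y = 0) \<and> (\<forall>R\<in>\<R>. \<exists>k. \<forall>(x, y)\<in>R. M x y = k)"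
    (is "_ \<longleftrightarrow> ?zero \<and> ?const")
proof -
  have sum_val: "(\<Sum>S\<in>\<R>. c S * adj S x y) = c R" if "R \<in> \<R>" "(x, y) \<in> R" for R x y and c :: "_ \<Rightarrow> real"
  proof -
    have "(\<Sum>S\<in>\<R>. c S * adj S x y) = (\<Sum>S\<in>\<R>. if S = R then c R else 0)"
      using partition_onD2[OF part] that
      by (intro sum.cong refl) (auto simp: adj_def disjoint_def)
    then show ?thesis using that fin by simp
  qed
  have sum_out: "(\<Sum>S\<in>\<R>. c S * adj S x y) = 0" if "(x, y) \<notin> X \<times> X" for x y and c :: "_ \<Rightarrow> real"
    using partition_onD1[OF part] that by (intro sum.neutral) (auto simp: adj_def)
  show ?thesis
  proof
    assume "M \<in> bose_mesner \<R>"
    then obtain c where M: "M = (\<lambda>x y. \<Sum>S\<in>\<R>. c S * adj S x y)" by (auto simp: bose_mesner_def)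
    have "\<exists>k. \<forall>(x, y)\<in>R. M x y = k" if "R \<in> \<R>" for R
      using sum_val[OF that] by (intro exI[of _ "c R"]) (auto simp: M)
    then show "?zero \<and> ?const" using sum_out by (auto simp: M)
  next
    assume asm: "?zero \<and> ?const"
    then obtain k where "\<forall>R\<in>\<R>. \<forall>(x, y)\<in>R. M x y = k R" using bchoice[of \<R>] by meson
    then have k: "M x y = k R" if "R \<in> \<R>" "(x, y) \<in> R" for R x y using that by blast
    have "M x y = (\<Sum>S\<in>\<R>. k S * adj S x y)" for x y
    proof (cases "(x, y) \<in> X \<times> X")
      case True
      then obtain R where "R \<in> \<R>" "(x, y) \<in> R" using partition_onD1[OF part] by blast
      then show ?thesis using sum_val k by simp
    next
      case False
      then show ?thesis using sum_out asm by simp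
    qed
    then have "M = (\<lambda>x y. \<Sum>S\<in>\<R>. k S * adj S x y)" by blast
    then show "M \<in> bose_mesner \<R>" unfolding bose_mesner_def by blast
  qed
qed

text \<open>With pointwise addition this makes the matrices a real vector space, so that the
  counting argument in \<open>card_rels\<close> can use linear independence.\<close>

definition mat_scale :: "real \<Rightarrow> 'a sqmat \<Rightarrow> 'a sqmat" where
  "mat_scale k M = (\<lambda>x y. k * M x y)"

interpretation mat: vector_space "mat_scale :: real \<Rightarrow> 'a sqmat \<Rightarrow> 'a sqmat"
  by unfold_locales (auto simp: mat_scale_def fun_eq_iff algebra_simps)

lemma sum_mat_apply:
  fixes f :: "'b \<Rightarrow> 'a sqmat"
  shows "(\<Sum>i\<in>A. f i) x y = (\<Sum>i\<in>A. f i x y)"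
  by (induction A rule: infinite_finite_induct) auto

lemma mat_scale_apply [simp]: "mat_scale k M x y = k * M x y"
  by (simp add: mat_scale_def)

lemma bose_mesner_subset_span:
  assumes "finite \<R>"
  shows "bose_mesner \<R> \<subseteq> mat.span (adj ` \<R>)"
proof
  fix M assume "M \<in> bose_mesner \<R>"
  then obtain c where "M = (\<lambda>x y. \<Sum>S\<in>\<R>. c S * adj S x y)" by (auto simp: bose_mesner_def)
  then have "M = (\<Sum>S\<in>\<R>. mat_scale (c S) (adj S))" by (simp add: fun_eq_iff sum_mat_apply)
  then show "M \<in> mat.span (adj ` \<R>)"
    by (metis (no_types, lifting) imageI mat.span_sum mat.span_scale mat.span_base)
qed

section \<open>Partitions into symmetric relations\<close>

locale symmetric_partition =
  fixes X :: "'a set" and \<R> :: "('a \<times> 'a) set set"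
  assumes finite_X: "finite X" and X_nonempty: "X \<noteq> {}"
    and part: "partition_on (X \<times> X) \<R>"
    and Id_mem: "Id_on X \<in> \<R>" and sym_rel: "\<And>R. R \<in> \<R> \<Longrightarrow> sym R"
begin

lemma finite_rels: "finite \<R>"
  using finite_elements[OF _ part] finite_X by simp

lemmas bm_iff = bose_mesner_iff[OF part finite_rels]

lemma card_pos: "card X > 0"
  using finite_X X_nonempty by (simp add: card_gt_0_iff)

lemma bm_outside: "M \<in> bose_mesner \<R> \<Longrightarrow> x \<notin> X \<or> y \<notin> X \<Longrightarrow> M x y = 0"
  by (auto simp: bm_iff)

lemma bm_const: "M \<in> bose_mesner \<R> \<Longrightarrow> R \<in> \<R> \<Longrightarrow> (x, y) \<in> R \<Longrightarrow> (x', y') \<in> R \<Longrightarrow> M x y = M x' y'"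
  unfolding bm_iff by (elim conjE ballE[where x = R] exE) (auto dest: bspec)

lemma bm_diag: "M \<in> bose_mesner \<R> \<Longrightarrow> x \<in> X \<Longrightarrow> x' \<in> X \<Longrightarrow> M x x = M x' x'"
  using bm_const[OF _ Id_mem] by (auto simp: Id_on_def)

lemma bm_sym:
  assumes "M \<in> bose_mesner \<R>"
  shows "M x y = M y x"
proof (cases "x \<in> X \<and> y \<in> X")
  case True
  then obtain R where R: "R \<in> \<R>" "(x, y) \<in> R" using partition_onD1[OF part] by blast
  then have "(y, x) \<in> R" using sym_rel by (meson symD)
  then show ?thesis using bm_const[OF assms] R by blast
qed (use bm_outside[OF assms] in auto)

lemma rel_nonempty:
  assumes "R \<in> \<R>"
  obtains x y where "(x, y) \<in> R"
  using assms partition_onD3[OF part] by (metis ex_in_conv surj_pair)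

lemma bm_lincomb:
  assumes "\<And>i. i \<in> I \<Longrightarrow> M i \<in> bose_mesner \<R>"
  shows "(\<lambda>x y. \<Sum>i\<in>I. f i * M i x y) \<in> bose_mesner \<R>"
  unfolding bm_iff
proof (intro conjI allI impI ballI)
  fix x y assume "(x, y) \<notin> X \<times> X"
  then show "(\<Sum>i\<in>I. f i * M i x y) = 0" using bm_outside[OF assms] by (intro sum.neutral) auto
next
  fix R assume R: "R \<in> \<R>"
  then obtain x y where xy: "(x, y) \<in> R" using rel_nonempty by blast
  show "\<exists>k. \<forall>(x, y)\<in>R. (\<Sum>i\<in>I. f i * M i x y) = k"
  proof (intro exI[of _ "\<Sum>i\<in>I. f i * M i x y"], clarify)
    fix x' y' assume "(x', y') \<in> R"
    then show "(\<Sum>i\<in>I. f i * M i x' y') = (\<Sum>i\<in>I. f i * M i x y)"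
      using bm_const[OF assms R] xy by (intro sum.cong refl) (metis (no_types))
  qed
qed

lemma bm_schur:
  assumes "M \<in> bose_mesner \<R>" "N \<in> bose_mesner \<R>"
  shows "schur M N \<in> bose_mesner \<R>"
  unfolding bm_iff
proof (intro conjI allI impI ballI)
  fix x y assume "(x, y) \<notin> X \<times> X"
  then show "schur M N x y = 0" using bm_outside[OF assms(1), of x y] by (auto simp: schur_def)
next
  fix R assume R: "R \<in> \<R>"
  then obtain x y where xy: "(x, y) \<in> R" using rel_nonempty by blast
  show "\<exists>k. \<forall>(x, y)\<in>R. schur M N x y = k"
  proof (intro exI[of _ "schur M N x y"], clarify)
    fix x' y' assume xy': "(x', y') \<in> R"
    show "schur M N x' y' = schur M N x y"
      using bm_const[OF assms(1) R xy' xy] bm_const[OF assms(2) R xy' xy] by (simp add: schur_def)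
  qed
qed

lemma bm_diff:
  assumes "M \<in> bose_mesner \<R>" "N \<in> bose_mesner \<R>"
  shows "(\<lambda>x y. M x y - N x y) \<in> bose_mesner \<R>"
proof -
  have "(\<lambda>x y. \<Sum>b\<in>UNIV. (if b then 1 else - 1) * (if b then M else N) x y) \<in> bose_mesner \<R>"
    using assms by (intro bm_lincomb) auto
  then show ?thesis by (simp add: UNIV_bool add.commute)
qed

lemma adj_mult: "(\<Sum>z\<in>X. adj R x z * adj S z y) = real (card {z \<in> X. (x, z) \<in> R \<and> (z, y) \<in> S})"
proof -
  have "(\<Sum>z\<in>X. adj R x z * adj S z y) = (\<Sum>z\<in>X. if (x, z) \<in> R \<and> (z, y) \<in> S then 1 else 0)"
    unfolding adj_def by (intro sum.cong) auto
  then show ?thesis using finite_X by (simp add: sum.If_cases Int_def)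
qed

end

text \<open>Only an upper bound on the number of relations is assumed: this is what restriction
  provides, and the idempotents force equality in \<open>card_rels\<close>. Both the given scheme
  and the dismantled one are instances.\<close>

locale orthogonal_idempotents = symmetric_partition X \<R>
  for X :: "'a set" and \<R> :: "('a \<times> 'a) set set" +
  fixes d :: nat and E :: "nat \<Rightarrow> 'a sqmat"
  assumes card_le: "card \<R> \<le> Suc d"
    and E_mem: "\<And>j. j \<le> d \<Longrightarrow> E j \<in> bose_mesner \<R>"
    and E_mult: "\<And>i j. i \<le> d \<Longrightarrow> j \<le> d \<Longrightarrow>
      mat_mult X (E i) (E j) = (if i = j then E i else mat_zero)"
    and E_nonzero: "\<And>j. j \<le> d \<Longrightarrow> E j \<noteq> mat_zero"
    and E_0: "E 0 = (\<lambda>x y. 1 / real (card X) * adj (X \<times> X) x y)"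
begin

lemmas E_sym = bm_sym[OF E_mem]
lemmas E_outside = bm_outside[OF E_mem]

text \<open>The trace of the idempotent \<open>E h\<close>, that is its rank: the multiplicity of
  the eigenspace.\<close>

definition mult :: "nat \<Rightarrow> real" where "mult h = (\<Sum>x\<in>X. E h x x)"

lemma E_mult_apply: "i \<le> d \<Longrightarrow> j \<le> d \<Longrightarrow> (\<Sum>z\<in>X. E i x z * E j z y) = (if i = j then E i x y else 0)"
  using E_mult[of i j] by (auto simp: mat_mult_def fun_eq_iff mat_zero_def)

text \<open>Since \<open>E j\<close> is symmetric, the Frobenius inner product is the trace of the
  matrix product.\<close>

lemma E_inner:
  assumes "i \<le> d" "j \<le> d"
  shows "(\<Sum>x\<in>X. \<Sum>y\<in>X. E i x y * E j x y) = (if i = j then mult i else 0)"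
proof -
  have "(\<Sum>y\<in>X. E i x y * E j x y) = (if i = j then E i x x else 0)" for x
    using E_mult_apply[OF assms, of x x] E_sym[OF assms(2), of x] by simp
  then show ?thesis by (simp add: mult_def)
qed

text \<open>The trace is the squared Frobenius norm of a nonzero matrix.\<close>

lemma mult_pos:
  assumes "h \<le> d"
  shows "mult h > 0"
proof -
  obtain x y where xy: "E h x y \<noteq> 0" using E_nonzero[OF assms] by (auto simp: mat_zero_def fun_eq_iff)
  then have mem: "x \<in> X" "y \<in> X" using E_outside[OF assms] by blast+
  have "0 < E h x y * E h x y" using xy by (metis not_real_square_gt_zero)
  also have "\<dots> \<le> (\<Sum>y\<in>X. E h x y * E h x y)"
    by (rule member_le_sum) (use mem finite_X in auto)
  also have "\<dots> \<le> (\<Sum>x\<in>X. \<Sum>y\<in>X. E h x y * E h x y)"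
    by (rule member_le_sum[where f = "\<lambda>x. \<Sum>y\<in>X. E h x y * E h x y"])
      (use mem finite_X in \<open>auto intro: sum_nonneg\<close>)
  finally show ?thesis using E_inner[OF assms assms] by simp
qed

lemma E_diag:
  assumes "h \<le> d" "x \<in> X"
  shows "E h x x = mult h / card X"
proof -
  have "mult h = (\<Sum>y\<in>X. E h x x)"
    unfolding mult_def using bm_diag[OF E_mem] assms by (intro sum.cong refl) blast
  then show ?thesis using card_pos by simp
qed

text \<open>Coordinates in the idempotent basis. Matrix products act on them pointwise and
  \<open>comb_inner\<close> recovers each one, so computations in the algebra become computations
  with functions on the indices.\<close>

definition comb :: "(nat \<Rightarrow> real) \<Rightarrow> 'a sqmat" where
  "comb f = (\<lambda>x y. \<Sum>h=0..d. f h * E h x y)"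

lemma comb_mem: "comb f \<in> bose_mesner \<R>"
  unfolding comb_def by (rule bm_lincomb) (simp add: E_mem)

lemma comb_inner:
  assumes "j \<le> d"
  shows "(\<Sum>x\<in>X. \<Sum>y\<in>X. comb f x y * E j x y) = f j * mult j"
proof -
  have "(\<Sum>x\<in>X. \<Sum>y\<in>X. comb f x y * E j x y) = (\<Sum>h=0..d. f h * (\<Sum>x\<in>X. \<Sum>y\<in>X. E h x y * E j x y))"
    unfolding comb_def sum_distrib_right sum_distrib_left
    by (simp add: sum.swap[of _ "{0..d}"] mult_ac)
  also have "\<dots> = (\<Sum>h=0..d. if h = j then f j * mult j else 0)"
    using assms by (intro sum.cong refl) (auto simp: E_inner)
  finally show ?thesis using assms by simp
qed

lemma comb_eqD: "comb f = comb g \<Longrightarrow> h \<le> d \<Longrightarrow> f h = g h"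
  using comb_inner[of h f] comb_inner[of h g] mult_pos[of h] by simp

lemma comb_cong: "(\<And>h. h \<le> d \<Longrightarrow> f h = g h) \<Longrightarrow> comb f = comb g"
  unfolding comb_def by (intro ext sum.cong) auto

lemma comb_single: "i \<le> d \<Longrightarrow> comb (\<lambda>h. if h = i then k else 0) = (\<lambda>x y. k * E i x y)"
  by (simp add: comb_def if_distrib[of "\<lambda>u. u * _"] cong: if_cong)

lemma comb_single1: "i \<le> d \<Longrightarrow> comb (\<lambda>h. if h = i then 1 else 0) = E i"
  using comb_single[of i 1] by simp

lemma comb_add: "comb (\<lambda>h. f h + g h) x y = comb f x y + comb g x y"
  by (simp add: comb_def algebra_simps sum.distrib)

lemma comb_scale: "comb (\<lambda>h. k * f h) x y = k * comb f x y"
  by (simp add: comb_def sum_distrib_left mult_ac)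

lemma comb_diff: "comb (\<lambda>h. f h - g h) x y = comb f x y - comb g x y"
  by (simp add: comb_def algebra_simps sum_subtractf)

lemma comb_zero: "comb (\<lambda>h. 0) = mat_zero"
  by (simp add: comb_def mat_zero_def)

lemma comb_mult: "mat_mult X (comb f) (comb g) = comb (\<lambda>h. f h * g h)"
proof (intro ext)
  fix x y
  have "mat_mult X (comb f) (comb g) x y = (\<Sum>i=0..d. \<Sum>j=0..d. f i * g j * (\<Sum>z\<in>X. E i x z * E j z y))"
    unfolding mat_mult_def comb_def sum_product
    by (subst sum.swap, intro sum.cong refl, subst sum.swap) (simp add: sum_distrib_left mult_ac)
  also have "\<dots> = (\<Sum>i=0..d. \<Sum>j=0..d. if j = i then f i * g i * E i x y else 0)"
    by (intro sum.cong refl) (auto simp: E_mult_apply)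
  also have "\<dots> = comb (\<lambda>h. f h * g h) x y" by (simp add: comb_def)
  finally show "mat_mult X (comb f) (comb g) x y = comb (\<lambda>h. f h * g h) x y" .
qed

lemma inj_E: "inj_on E {0..d}"
proof (rule inj_onI)
  fix i j assume ij: "i \<in> {0..d}" "j \<in> {0..d}" "E i = E j"
  then have "E i = mat_zero" if "i \<noteq> j" using E_mult[of i j] E_mult[of i i] that by auto
  then show "i = j" using E_nonzero[of i] ij by auto
qed

lemma mat_sum_eq_comb: "(\<Sum>v\<in>E ` {0..d}. mat_scale (u v) v) = comb (u \<circ> E)"
  by (simp add: fun_eq_iff sum_mat_apply comb_def sum.reindex[OF inj_E])

lemma independent_E: "mat.independent (E ` {0..d})"
proof (rule mat.independent_if_scalars_zero)
  fix u v assume eq: "(\<Sum>v\<in>E ` {0..d}. mat_scale (u v) v) = 0" and v: "v \<in> E ` {0..d}"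
  then have "comb (u \<circ> E) = comb (\<lambda>h. 0)"
    by (simp add: mat_sum_eq_comb comb_zero mat_zero_def zero_fun_def)
  then show "u v = 0" using comb_eqD v by fastforce
qed simp

text \<open>Dimension count: the \<open>d + 1\<close> independent idempotents lie in the span of at
  most \<open>d + 1\<close> relation matrices, which leaves no room for fewer relations or for a
  further independent matrix.\<close>

lemma card_rels: "card \<R> = Suc d"
  and bm_eq_comb: "M \<in> bose_mesner \<R> \<Longrightarrow> \<exists>f. M = comb f"
proof -
  have cE: "card (E ` {0..d}) = Suc d" using card_image[OF inj_E] by simp
  have sub: "E ` {0..d} \<subseteq> mat.span (adj ` \<R>)"
    using bose_mesner_subset_span[OF finite_rels] E_mem by auto
  have "card (E ` {0..d}) \<le> card (adj ` \<R>)"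
    using mat.independent_span_bound[OF _ independent_E sub] finite_rels by simp
  moreover have "card (adj ` \<R>) \<le> card \<R>" using card_image_le finite_rels by blast
  ultimately show c: "card \<R> = Suc d" using card_le cE by linarith
  assume M: "M \<in> bose_mesner \<R>"
  have "M \<in> mat.span (E ` {0..d})"
  proof (rule ccontr)
    assume nM: "M \<notin> mat.span (E ` {0..d})"
    then have "mat.independent (insert M (E ` {0..d}))"
      using mat.independent_insertI independent_E by blast
    moreover have "insert M (E ` {0..d}) \<subseteq> mat.span (adj ` \<R>)"
      using sub M bose_mesner_subset_span[OF finite_rels] by blast
    ultimately have "card (insert M (E ` {0..d})) \<le> card (adj ` \<R>)"
      using mat.independent_span_bound finite_rels by blast
    moreover have "M \<notin> E ` {0..d}" using nM mat.span_base by blast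
    ultimately show False using \<open>card (adj ` \<R>) \<le> card \<R>\<close> c cE by simp
  qed
  then obtain u where "M = (\<Sum>v\<in>E ` {0..d}. mat_scale (u v) v)"
    by (auto simp: mat.span_finite)
  then show "\<exists>f. M = comb f" using mat_sum_eq_comb by blast
qed

lemma bm_mult:
  assumes "M \<in> bose_mesner \<R>" "N \<in> bose_mesner \<R>"
  shows "mat_mult X M N \<in> bose_mesner \<R>"
  using bm_eq_comb[OF assms(1)] bm_eq_comb[OF assms(2)] comb_mult comb_mem by metis

lemma adj_mem: "R \<in> \<R> \<Longrightarrow> adj R \<in> bose_mesner \<R>"
  unfolding bose_mesner_def using finite_rels
  by (auto intro!: exI[of _ "\<lambda>S. if S = R then 1 else 0"] simp: if_distrib[of "\<lambda>u. u * _"] cong: if_cong)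

text \<open>The number of \<open>z\<close> is an entry of the product of \<open>adj R\<close> and
  \<open>adj S\<close>. The span is closed under multiplication because the idempotents form a basis
  of it, so this entry is constant on \<open>T\<close>.\<close>

lemma association_scheme: "association_scheme X d \<R>"
  unfolding association_scheme_def
proof (intro conjI ballI)
  fix R S T assume RST: "R \<in> \<R>" "S \<in> \<R>" "T \<in> \<R>"
  have card_eq: "real (card {z \<in> X. (x, z) \<in> R \<and> (z, y) \<in> S}) = mat_mult X (adj R) (adj S) x y" for x y
    by (simp add: mat_mult_def adj_mult)
  obtain x y where xy: "(x, y) \<in> T" using RST rel_nonempty by blast
  show "\<exists>p. \<forall>(x, y)\<in>T. card {z \<in> X. (x, z) \<in> R \<and> (z, y) \<in> S} = p"
  proof (intro exI[of _ "card {z \<in> X. (x, z) \<in> R \<and> (z, y) \<in> S}"], clarify)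
    fix x' y' assume "(x', y') \<in> T"
    then have "mat_mult X (adj R) (adj S) x' y' = mat_mult X (adj R) (adj S) x y"
      using bm_const[OF bm_mult[OF adj_mem adj_mem]] RST xy by blast
    then show "card {z \<in> X. (x', z) \<in> R \<and> (z, y') \<in> S} = card {z \<in> X. (x, z) \<in> R \<and> (z, y) \<in> S}"
      by (simp only: card_eq[symmetric] of_nat_eq_iff)
  qed
qed (use finite_X X_nonempty part card_rels Id_mem sym_rel in auto)

lemma comb_idempotent: "comb f \<in> idempotents X \<R> \<longleftrightarrow> (\<forall>h\<le>d. f h = 0 \<or> f h = 1)"
proof
  assume "comb f \<in> idempotents X \<R>"
  then have "comb (\<lambda>h. f h * f h) = comb f" by (simp add: idempotents_def comb_mult)
  then show "\<forall>h\<le>d. f h = 0 \<or> f h = 1" using comb_eqD by fastforce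
next
  assume "\<forall>h\<le>d. f h = 0 \<or> f h = 1"
  then have "comb (\<lambda>h. f h * f h) = comb f" by (intro comb_cong) auto
  then show "comb f \<in> idempotents X \<R>" by (simp add: idempotents_def comb_mult comb_mem)
qed

lemma E_idempotent: "i \<le> d \<Longrightarrow> E i \<in> idempotents X \<R>"
  by (simp add: idempotents_def E_mem E_mult)

text \<open>The coordinates of two orthogonal summands have disjoint supports and add up to the
  indicator of \<open>i\<close>, so one of the summands vanishes.\<close>

lemma E_primitive:
  assumes i: "i \<le> d"
  shows "E i \<in> primitive_idempotents X \<R>"
  unfolding primitive_idempotents_def
proof (intro CollectI conjI ballI impI)
  fix F G assume FG: "F \<in> idempotents X \<R>" "G \<in> idempotents X \<R>"
    and *: "mat_mult X F G = mat_zero \<and> mat_mult X G F = mat_zero \<and> E i = mat_add F G"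
  obtain f g where fg: "F = comb f" "G = comb g" using FG bm_eq_comb by (fastforce simp: idempotents_def)
  have "comb (\<lambda>h. f h * g h) = comb (\<lambda>h. 0)" using * by (simp add: fg comb_mult comb_zero)
  then have prod: "f h = 0 \<or> g h = 0" if "h \<le> d" for h using comb_eqD that by fastforce
  have "comb (\<lambda>h. if h = i then 1 else 0) = comb (\<lambda>h. f h + g h)"
    using * i by (simp add: comb_single1 fg mat_add_def comb_add fun_eq_iff)
  then have sum: "f h + g h = (if h = i then 1 else 0)" if "h \<le> d" for h
    using comb_eqD that by fastforce
  show "F = mat_zero \<or> G = mat_zero"
  proof (cases "f i = 0")
    case True
    then have "F = comb (\<lambda>h. 0)" unfolding fg using sum prod by (intro comb_cong) (metis add_0 add.right_neutral)
    then show ?thesis by (simp add: comb_zero)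
  next
    case False
    then have "G = comb (\<lambda>h. 0)" unfolding fg using sum prod i by (intro comb_cong) (metis add_0 add.right_neutral)
    then show ?thesis by (simp add: comb_zero)
  qed
qed (use i E_idempotent E_nonzero in auto)

lemma idempotent_ordering: "idempotent_ordering X d \<R> E"
  unfolding idempotent_ordering_def bij_betw_def
proof (intro conjI equalityI subsetI)
  fix M assume M: "M \<in> primitive_idempotents X \<R>"
  then have "M \<in> idempotents X \<R>" "M \<noteq> mat_zero" by (auto simp: primitive_idempotents_def)
  then obtain f where f: "M = comb f" using bm_eq_comb by (auto simp: idempotents_def)
  have f01: "f h = 0 \<or> f h = 1" if "h \<le> d" for h
    using comb_idempotent[of f] f \<open>M \<in> idempotents X \<R>\<close> that by blast
  obtain i where i: "i \<le> d" "f i = 1"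
  proof -
    have "\<not> (\<forall>h\<le>d. f h = 0)"
      using \<open>M \<noteq> mat_zero\<close> comb_cong[of f "\<lambda>h. 0"] by (auto simp: f comb_zero)
    then show thesis using that f01 by blast
  qed
  \<comment> \<open>Splitting off \<open>E i\<close> from \<open>M\<close> leaves an idempotent
    orthogonal to \<open>E i\<close>, which primitivity of \<open>M\<close> forces to be
    zero.\<close>
  define g where "g = f(i := 0)"
  have gi: "comb g \<in> idempotents X \<R>" using f01 by (auto simp: comb_idempotent g_def)
  have "mat_mult X (comb g) (E i) = comb (\<lambda>h. 0)" "mat_mult X (E i) (comb g) = comb (\<lambda>h. 0)"
    unfolding comb_single1[OF i(1), symmetric] comb_mult by (auto simp: g_def intro!: comb_cong)
  moreover have "M = mat_add (E i) (comb g)"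
  proof -
    have "M = comb (\<lambda>h. (if h = i then 1 else 0) + g h)"
      unfolding f using i by (intro comb_cong) (auto simp: g_def)
    then show ?thesis using i by (simp add: fun_eq_iff comb_add mat_add_def comb_single1)
  qed
  ultimately have "E i = mat_zero \<or> comb g = mat_zero"
    using M E_idempotent[OF i(1)] gi by (auto simp: primitive_idempotents_def comb_zero)
  then have "comb g = mat_zero" using E_nonzero i by blast
  then have "M = E i" using \<open>M = mat_add (E i) (comb g)\<close> by (simp add: mat_add_def mat_zero_def fun_eq_iff)
  then show "M \<in> E ` {0..d}" using i by auto
qed (use inj_E E_primitive E_0 in auto)

section \<open>Krein parameters and the cometric property\<close>

lemma schur_eq_comb:
  assumes "i \<le> d" "j \<le> d"
  shows "schur (E i) (E j) = (\<lambda>x y. 1 / real (card X) * comb (krein X d E i j) x y)"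
    and "h > d \<Longrightarrow> krein X d E i j h = 0"
proof -
  obtain f where f: "schur (E i) (E j) = comb f"
    using bm_eq_comb[OF bm_schur[OF E_mem E_mem]] assms by blast
  \<comment> \<open>The value 0 beyond \<open>d\<close> matches the normalisation in
    \<open>krein\<close>, which makes the description there unique.\<close>
  define q where "q h = (if h \<le> d then real (card X) * f h else 0)" for h
  have ex: "schur (E i) (E j) = (\<lambda>x y. 1 / real (card X) * comb q x y)"
  proof -
    have "comb q = comb (\<lambda>h. real (card X) * f h)" by (intro comb_cong) (simp add: q_def)
    then show ?thesis using card_pos by (simp add: f comb_scale fun_eq_iff)
  qed
  have "krein X d E i j = q"
    unfolding krein_def
  proof (rule the_equality)
    show "(\<forall>h>d. q h = 0) \<and> schur (E i) (E j) = (\<lambda>x y. 1 / real (card X) * (\<Sum>h = 0..d. q h * E h x y))"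
      using ex by (simp add: comb_def q_def)
  next
    fix r assume r: "(\<forall>h>d. r h = 0) \<and>
      schur (E i) (E j) = (\<lambda>x y. 1 / real (card X) * (\<Sum>h = 0..d. r h * E h x y))"
    then have "comb r = comb q" using ex card_pos by (simp add: comb_def fun_eq_iff)
    then show "r = q" using comb_eqD r by (metis not_le q_def ext)
  qed
  then show "schur (E i) (E j) = (\<lambda>x y. 1 / real (card X) * comb (krein X d E i j) x y)"
    and "h > d \<Longrightarrow> krein X d E i j h = 0"
    using ex by (auto simp: q_def)
qed

lemma E_times_E:
  assumes "i \<le> d" "j \<le> d"
  shows "real (card X) * (E i x y * E j x y) = comb (krein X d E i j) x y"
  using fun_cong[OF fun_cong[OF schur_eq_comb(1)[OF assms]], of x y] card_pos by (simp add: schur_def)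

lemma krein_eqI:
  assumes "i \<le> d" "j \<le> d" "h \<le> d"
    and "\<And>x y. real (card X) * (E i x y * E j x y) = comb q x y"
  shows "krein X d E i j h = q h"
  using assms E_times_E by (intro comb_eqD) (auto simp: fun_eq_iff)

text \<open>The right-hand side is invariant under permuting \<open>i\<close>, \<open>j\<close> and
  \<open>h\<close>; the exchange rules \<open>krein_rotate\<close> and \<open>krein_commute\<close>
  follow.\<close>

lemma krein_triple:
  assumes "i \<le> d" "j \<le> d" "h \<le> d"
  shows "mult h * krein X d E i j h = real (card X) * (\<Sum>x\<in>X. \<Sum>y\<in>X. E i x y * E j x y * E h x y)"
  using comb_inner[OF assms(3), of "krein X d E i j"] E_times_E[OF assms(1,2), symmetric]
  by (simp add: sum_distrib_left mult_ac)

lemma krein_rotate: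
  assumes "i \<le> d" "j \<le> d" "h \<le> d"
  shows "mult h * krein X d E i j h = mult j * krein X d E i h j"
  using krein_triple[OF assms] krein_triple[OF assms(1,3,2)] by (simp add: mult_ac)

lemma krein_commute:
  assumes "i \<le> d" "j \<le> d" "h \<le> d"
  shows "krein X d E i j h = krein X d E j i h"
proof -
  have "mult h * krein X d E i j h = mult h * krein X d E j i h"
    using krein_triple[OF assms] krein_triple[OF assms(2,1,3)] by (simp add: mult_ac)
  then show ?thesis using mult_pos[OF assms(3)] by simp
qed

lemma krein_0:
  assumes "j \<le> d" "h \<le> d"
  shows "krein X d E 0 j h = (if h = j then 1 else 0)"
proof (rule krein_eqI)
  fix x y
  show "real (card X) * (E 0 x y * E j x y) = comb (\<lambda>h. if h = j then 1 else 0) x y"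
    using card_pos E_outside[OF assms(1)] by (cases "x \<in> X \<and> y \<in> X")
     (auto simp: E_0 adj_def comb_single1 assms)
qed (use assms in auto)

text \<open>Expanding \<open>E\<^sub>1 \<circ> E\<^sub>i \<circ> E\<^sub>j\<close> in two ways.\<close>

lemma krein_recurrence:
  assumes "i \<le> d" "j \<le> d" "h \<le> d" "1 \<le> d"
  shows "(\<Sum>k=0..d. krein X d E 1 i k * krein X d E k j h) = (\<Sum>k=0..d. krein X d E i j k * krein X d E 1 k h)"
proof -
  let ?q = "krein X d E" and ?N = "real (card X)"
  have "comb (\<lambda>h. \<Sum>k=0..d. ?q 1 i k * ?q k j h) x y = comb (\<lambda>h. \<Sum>k=0..d. ?q i j k * ?q 1 k h) x y" for x y
  proof -
    have comb_sum: "comb (\<lambda>h. \<Sum>k=0..d. f k * g k h) x y = (\<Sum>k=0..d. f k * comb (g k) x y)" for f g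
      unfolding comb_def sum_distrib_left sum_distrib_right by (subst sum.swap) (simp add: mult_ac)
    have "(\<Sum>k=0..d. ?q 1 i k * comb (?q k j) x y) = ?N * E j x y * comb (?q 1 i) x y"
      unfolding comb_def[of "?q 1 i"] sum_distrib_left
      using assms E_times_E[symmetric] by (intro sum.cong) (auto simp: mult_ac)
    moreover have "(\<Sum>k=0..d. ?q i j k * comb (?q 1 k) x y) = ?N * E 1 x y * comb (?q i j) x y"
      unfolding comb_def[of "?q i j"] sum_distrib_left
      using assms E_times_E[symmetric] by (intro sum.cong) (auto simp: mult_ac)
    moreover have "?N * E j x y * comb (?q 1 i) x y = ?N * E 1 x y * comb (?q i j) x y"
      using assms by (simp add: E_times_E[symmetric] mult_ac)
    ultimately show ?thesis by (simp only: comb_sum)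
  qed
  then show ?thesis using comb_eqD[of "\<lambda>h. \<Sum>k=0..d. ?q 1 i k * ?q k j h"] assms(3) by blast
qed

text \<open>By induction on \<open>i\<close>, the recurrence for \<open>E 1\<close> and
  \<open>E (i - 1)\<close> carries the conditions on \<open>E 1\<close> over to all
  \<open>E i\<close>. The lower triangle bound is the upper one with two indices exchanged by
  \<open>krein_rotate\<close>.\<close>

lemma cometric_criterion:
  assumes d1: "1 \<le> d"
    and upper: "\<And>j h. j \<le> d \<Longrightarrow> h \<le> d \<Longrightarrow> h > j + 1 \<Longrightarrow> krein X d E 1 j h = 0"
    and pos: "\<And>j. j < d \<Longrightarrow> krein X d E 1 j (j + 1) > 0"
  shows "cometric X d \<R> E"
proof -
  let ?q = "krein X d E"
  have main: "(\<forall>h\<le>d. h > i + j \<longrightarrow> ?q i j h = 0) \<and> (i + j \<le> d \<longrightarrow> ?q i j (i + j) > 0)"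
    if "i \<le> d" "j \<le> d" for i j
    using that(1)
  proof (induction i rule: less_induct)
    case (less i)
    show ?case
    proof (cases i)
      case 0
      then show ?thesis using krein_0[OF that(2)] by auto
    next
      case (Suc k)
      have k: "k \<le> d" "k < d" using less.prems Suc by auto
      \<comment> \<open>For \<open>m < i\<close> the second factor vanishes by induction, and for
        \<open>m > i\<close> the first one by \<open>upper\<close>, as
        \<open>i = k + 1\<close>.\<close>
      have lhs: "(\<Sum>m=0..d. ?q 1 k m * ?q m j h) = ?q 1 k i * ?q i j h" if h: "h \<le> d" "h \<ge> i + j" for h
      proof -
        have "(\<Sum>m=0..d. ?q 1 k m * ?q m j h) = (\<Sum>m\<in>{i}. ?q 1 k m * ?q m j h)"
        proof (rule sum.mono_neutral_right)
          show "\<forall>m\<in>{0..d} - {i}. ?q 1 k m * ?q m j h = 0"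
          proof
            fix m assume m: "m \<in> {0..d} - {i}"
            show "?q 1 k m * ?q m j h = 0"
            proof (cases "m < i")
              case True
              then have "?q m j h = 0" using less.IH[of m] m h by auto
              then show ?thesis by simp
            next
              case False
              then have "?q 1 k m = 0" using upper[OF k(1)] m Suc by auto
              then show ?thesis by simp
            qed
          qed
        qed (use less.prems in auto)
        then show ?thesis by simp
      qed
      have IH: "?q k j m = 0" if "m \<le> d" "m > k + j" for m using less.IH[of k] k Suc that by simp
      have ci: "?q 1 k i > 0" using pos[OF k(2)] Suc by simp
      have rec: "?q 1 k i * ?q i j h = (\<Sum>m=0..d. ?q k j m * ?q 1 m h)" if h: "h \<le> d" "h \<ge> i + j" for h
        using krein_recurrence[OF k(1) \<open>j \<le> d\<close> h(1) d1] lhs[OF h] by simp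
      have "?q i j h = 0" if h: "h \<le> d" "h > i + j" for h
      proof -
        have "(\<Sum>m=0..d. ?q k j m * ?q 1 m h) = 0"
        proof (intro sum.neutral ballI)
          fix m assume m: "m \<in> {0..d}"
          show "?q k j m * ?q 1 m h = 0"
            using IH[of m] upper[of m h] m h Suc by (cases "m > k + j") auto
        qed
        then show ?thesis using rec[of h] h ci by simp
      qed
      moreover have "?q i j (i + j) > 0" if ij: "i + j \<le> d"
      proof -
        \<comment> \<open>Only \<open>m = k + j\<close> survives: a larger index is excluded by
          induction and a smaller one by \<open>upper\<close>.\<close>
        have "(\<Sum>m=0..d. ?q k j m * ?q 1 m (i + j)) = (\<Sum>m\<in>{k + j}. ?q k j m * ?q 1 m (i + j))"
        proof (rule sum.mono_neutral_right)
          show "\<forall>m\<in>{0..d} - {k + j}. ?q k j m * ?q 1 m (i + j) = 0"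
          proof
            fix m assume m: "m \<in> {0..d} - {k + j}"
            then show "?q k j m * ?q 1 m (i + j) = 0"
              using IH[of m] upper[of m "i + j"] m ij Suc by (cases "m > k + j") auto
          qed
        qed (use ij Suc in auto)
        moreover have "?q k j (k + j) > 0" using less.IH[of k] k ij Suc by simp
        moreover have "?q 1 (k + j) (i + j) > 0" using pos[of "k + j"] ij Suc by simp
        ultimately have "?q 1 k i * ?q i j (i + j) > 0" using rec[of "i + j"] ij by simp
        then show ?thesis using ci by (simp add: zero_less_mult_iff)
      qed
      ultimately show ?thesis by blast
    qed
  qed
  have low: "?q i j h = 0" if "i \<le> d" "j \<le> d" "h \<le> d" "h + i < j" for i j h
  proof -
    have "?q i h j = 0" using main[of i h] that by simp
    then show ?thesis using krein_rotate[of i j h] mult_pos[of h] that by simp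
  qed
  show ?thesis
    unfolding cometric_def
  proof (intro conjI allI impI)
    fix i j h assume ijh: "i \<le> d" "j \<le> d" "h \<le> d" "int h < \<bar>int i - int j\<bar> \<or> h > i + j"
    then consider "h + i < j" | "h + j < i" | "h > i + j" by linarith
    then show "?q i j h = 0"
      using low[of i j h] low[of j i h] main[of i j] krein_commute[of i j h] ijh by cases auto
  next
    fix i j assume "i + j \<le> d"
    then show "?q i j (i + j) > 0" using main[of i j] by simp
  qed (rule association_scheme, rule idempotent_ordering)
qed

end

text \<open>Primitivity is stated inside the algebra, so orthogonality has to be derived: the
  product of two primitive idempotents is an idempotent that splits the first factor
  orthogonally.\<close>

lemma orthogonal_idempotents_intro:
  assumes scheme: "association_scheme X d \<R>" and ord: "idempotent_ordering X d \<R> E"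
  shows "orthogonal_idempotents X \<R> d E"
proof -
  have part: "partition_on (X \<times> X) \<R>" and finX: "finite X" and cR: "card \<R> = Suc d"
    and symR: "\<And>R. R \<in> \<R> \<Longrightarrow> sym R" and ne: "X \<noteq> {}" and Id: "Id_on X \<in> \<R>"
    using scheme by (auto simp: association_scheme_def)
  interpret symmetric_partition X \<R>
    by unfold_locales (use finX ne part Id symR in auto)
  have mult: "mat_mult X M N \<in> bose_mesner \<R>" if MN: "M \<in> bose_mesner \<R>" "N \<in> bose_mesner \<R>" for M N
    unfolding bm_iff
  proof (intro conjI allI impI ballI)
    fix x y assume "(x, y) \<notin> X \<times> X"
    then show "mat_mult X M N x y = 0"
      using bm_outside[OF MN(1), of x] bm_outside[OF MN(2), of _ y] unfolding mat_mult_def by (intro sum.neutral) auto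
  next
    fix T assume T: "T \<in> \<R>"
    obtain f g where fg: "M = (\<lambda>x y. \<Sum>R\<in>\<R>. f R * adj R x y)" "N = (\<lambda>x y. \<Sum>R\<in>\<R>. g R * adj R x y)"
      using MN by (auto simp: bose_mesner_def)
    have eq: "mat_mult X M N x y =
      (\<Sum>R\<in>\<R>. \<Sum>S\<in>\<R>. f R * g S * real (card {z \<in> X. (x, z) \<in> R \<and> (z, y) \<in> S}))" for x y
    proof -
      have "mat_mult X M N x y = (\<Sum>R\<in>\<R>. \<Sum>S\<in>\<R>. f R * g S * (\<Sum>z\<in>X. adj R x z * adj S z y))"
        unfolding mat_mult_def fg sum_product
        by (subst sum.swap, intro sum.cong refl, subst sum.swap) (simp add: sum_distrib_left mult_ac)
      then show ?thesis by (simp only: adj_mult)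
    qed
    have p: "card {z \<in> X. (x, z) \<in> R \<and> (z, y) \<in> S} = card {z \<in> X. (x', z) \<in> R \<and> (z, y') \<in> S}"
      if "R \<in> \<R>" "S \<in> \<R>" "(x, y) \<in> T" "(x', y') \<in> T" for R S x y x' y'
    proof -
      obtain p where p: "\<forall>(x, y)\<in>T. card {z \<in> X. (x, z) \<in> R \<and> (z, y) \<in> S} = p"
        using scheme \<open>R \<in> \<R>\<close> \<open>S \<in> \<R>\<close> T unfolding association_scheme_def by meson
      show ?thesis using bspec[OF p that(3)] bspec[OF p that(4)] by simp
    qed
    obtain x y where xy: "(x, y) \<in> T" using T rel_nonempty by blast
    show "\<exists>k. \<forall>(x, y)\<in>T. mat_mult X M N x y = k"
    proof (intro exI[of _ "mat_mult X M N x y"], clarify)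
      fix x' y' assume "(x', y') \<in> T"
      then show "mat_mult X M N x' y' = mat_mult X M N x y"
        unfolding eq using p[OF _ _ _ xy] by (intro sum.cong refl) simp
    qed
  qed
  \<comment> \<open>Products stay in the algebra and so are symmetric; transposing therefore
    exchanges the factors.\<close>
  have comm: "mat_mult X M N = mat_mult X N M" if MN: "M \<in> bose_mesner \<R>" "N \<in> bose_mesner \<R>" for M N
  proof (intro ext)
    fix x y
    have "mat_mult X M N x y = mat_mult X M N y x" using bm_sym[OF mult[OF MN]] .
    also have "\<dots> = mat_mult X N M x y"
      unfolding mat_mult_def using bm_sym[OF MN(1)] bm_sym[OF MN(2)] by (intro sum.cong) (auto simp: mult_ac)
    finally show "mat_mult X M N x y = mat_mult X N M x y" .
  qed
  have prim_mem: "F \<in> bose_mesner \<R>" "mat_mult X F F = F" "F \<noteq> mat_zero" if "F \<in> primitive_idempotents X \<R>" for F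
    using that by (auto simp: primitive_idempotents_def idempotents_def)
  have absorb: "mat_mult X F G = mat_zero \<or> mat_mult X F G = F"
    if F: "F \<in> primitive_idempotents X \<R>" and G: "G \<in> primitive_idempotents X \<R>" for F G
  proof -
    define P where "P = mat_mult X F G"
    define Q where "Q = (\<lambda>x y. F x y - P x y)"
    have P: "P \<in> bose_mesner \<R>" using mult prim_mem F G by (simp add: P_def)
    then have Q: "Q \<in> bose_mesner \<R>" using bm_diff prim_mem F by (simp add: Q_def)
    have FP: "mat_mult X F P = P" using prim_mem[OF F] by (simp add: P_def mat_mult_assoc[symmetric])
    have PF: "mat_mult X P F = P" using FP comm P prim_mem F by metis
    have PG: "mat_mult X P G = P" using prim_mem[OF G] by (simp add: P_def mat_mult_assoc)
    have PP: "mat_mult X P P = P"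
    proof -
      have "mat_mult X P P = mat_mult X (mat_mult X P F) G" by (simp add: P_def mat_mult_assoc)
      then show ?thesis using PF PG by simp
    qed
    have PQ: "mat_mult X P Q = mat_zero" "mat_mult X Q P = mat_zero"
      by (simp_all add: Q_def mat_mult_diff_left mat_mult_diff_right FP PF PP mat_zero_def)
    have "mat_mult X Q Q = Q"
      by (simp add: Q_def mat_mult_diff_left mat_mult_diff_right FP PF PP prim_mem[OF F])
    then have "P \<in> idempotents X \<R>" "Q \<in> idempotents X \<R>" using P Q PP by (auto simp: idempotents_def)
    moreover have "F = mat_add P Q" by (simp add: mat_add_def Q_def)
    ultimately have "P = mat_zero \<or> Q = mat_zero"
      using F PQ unfolding primitive_idempotents_def by blast
    moreover have "Q = mat_zero \<Longrightarrow> P = F" by (simp add: Q_def mat_zero_def fun_eq_iff)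
    ultimately show ?thesis unfolding P_def by blast
  qed
  have bij: "bij_betw E {0..d} (primitive_idempotents X \<R>)" using ord by (simp add: idempotent_ordering_def)
  have prim: "E j \<in> primitive_idempotents X \<R>" if "j \<le> d" for j using bij that by (auto simp: bij_betw_def)
  show ?thesis
  proof
    fix i j assume ij: "i \<le> d" "j \<le> d"
    show "mat_mult X (E i) (E j) = (if i = j then E i else mat_zero)"
    proof (cases "i = j")
      case True
      then show ?thesis using prim_mem prim ij by simp
    next
      case False
      then have "E i \<noteq> E j" using bij ij by (auto simp: bij_betw_def inj_on_def)
      \<comment> \<open>A nonzero product would equal \<open>E i\<close> and, by commutativity, also
        \<open>E j\<close>.\<close>
      moreover have "mat_mult X (E i) (E j) = mat_mult X (E j) (E i)" using comm prim_mem prim ij by blast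
      ultimately show ?thesis using absorb[OF prim prim] ij False by metis
    qed
  qed (use finX ne part cR Id symR prim prim_mem ord in \<open>auto simp: idempotent_ordering_def\<close>)
qed

section \<open>The fibre matrix\<close>

locale Q_antipodal_scheme = orthogonal_idempotents X \<R> d E
  for X :: "'a set" and \<R> :: "('a \<times> 'a) set set" and d :: nat and E :: "nat \<Rightarrow> 'a sqmat" +
  fixes n w :: nat
  assumes cometric: "cometric X d \<R> E" and equiv_fibre: "equiv X (fibre_rel X d E)"
    and card_fibre: "\<And>V. V \<in> fibres X d E \<Longrightarrow> card V = n"
    and fibre_matrix: "(\<lambda>x y. real n * (E 0 x y + E d x y)) = adj (fibre_rel X d E)"
    and card_fibres: "card (fibres X d E) = w" and w_ge: "w \<ge> 2" and d_ge: "d \<ge> 3"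
begin

abbreviation fib :: "'a sqmat" where "fib \<equiv> adj (fibre_rel X d E)"
abbreviation q :: "nat \<Rightarrow> nat \<Rightarrow> nat \<Rightarrow> real" where "q \<equiv> krein X d E"

lemma krein_vanish: "i \<le> d \<Longrightarrow> j \<le> d \<Longrightarrow> h \<le> d \<Longrightarrow> h + i < j \<or> h + j < i \<or> i + j < h \<Longrightarrow> q i j h = 0"
  using cometric unfolding cometric_def by (auto simp: abs_if)

lemma krein_top_pos: "i + j \<le> d \<Longrightarrow> q i j (i + j) > 0"
  using cometric unfolding cometric_def by blast

lemma finite_fibres: "finite (fibres X d E)"
  using card_fibres w_ge card.infinite by fastforce

lemma card_Union_fibres:
  assumes "\<F> \<subseteq> fibres X d E"
  shows "card (\<Union>\<F>) = n * card \<F>"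
proof (rule card_partition[symmetric])
  show "finite \<F>" using assms finite_fibres finite_subset by blast
  show "finite (\<Union>\<F>)"
    using assms Union_quotient[OF equiv_fibre] finite_X by (metis Union_mono finite_subset fibres_def)
  show "card V = n" if "V \<in> \<F>" for V using that assms card_fibre by blast
  show "U \<inter> V = {}" if "U \<in> \<F>" "V \<in> \<F>" "U \<noteq> V" for U V
    using that assms quotient_disj[OF equiv_fibre] unfolding fibres_def by blast
qed

lemma card_X: "real (card X) = real n * real w"
  using card_Union_fibres[of "fibres X d E"] Union_quotient[OF equiv_fibre] card_fibres
  by (simp add: fibres_def)

lemma n_pos: "n > 0"
  using card_X card_pos by (metis mult_eq_0_iff of_nat_0 of_nat_0_less_iff less_irrefl gr0I)

lemma w_pos: "real w > 0"
  using w_ge by simp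

text \<open>Entrywise multiplication by a 0/1 matrix is idempotent, so it fixes its image.\<close>

lemma fib_fixes_image: "fib x y * a = b / w \<Longrightarrow> fib x y * b = b"
  using w_pos by (auto simp: adj_def of_bool_def split: if_splits)

text \<open>Expand the fibre matrix as \<open>n (E 0 + E d)\<close>; the factor \<open>1 / w\<close>
  is \<open>n / card X\<close>. The unknown parameters \<open>q d j\<close> become visible as
  coordinates.\<close>

lemma fib_mult_E:
  assumes "j \<le> d"
  shows "fib x y * E j x y = (E j x y + comb (q d j) x y) / w"
proof -
  have "fib x y * E j x y = n * (E 0 x y * E j x y) + n * (E d x y * E j x y)"
    unfolding fibre_matrix[symmetric] by (simp add: algebra_simps)
  moreover have "n * (E 0 x y * E j x y) = E j x y / w"
    using n_pos w_pos E_outside[OF assms, of x y]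
    by (cases "x \<in> X \<and> y \<in> X") (auto simp: E_0 adj_def card_X field_simps)
  moreover have "n * (E d x y * E j x y) = comb (q d j) x y / w"
    using E_times_E[of d j x y] n_pos w_pos assms by (simp add: card_X field_simps)
  ultimately show ?thesis by (simp add: add_divide_distrib)
qed

lemma comb_two:
  assumes "i \<le> d" "k \<le> d"
  shows "comb (\<lambda>h. (if h = i then a else 0) + (if h = k then b else 0)) x y = a * E i x y + b * E k x y"
  by (simp add: comb_add comb_single assms)

text \<open>The sum \<open>E i + E (d - i)\<close> is a multiple of the image of \<open>E i\<close>
  under the fibre matrix and hence fixed by it; subtracting the known image of \<open>E i\<close>
  leaves that of \<open>E (d - i)\<close>.\<close>

lemma krein_d_high:
  assumes i: "2 * i < d" and low: "\<And>h. h \<le> d \<Longrightarrow> q d i h = (if h = d - i then 1 else 0)" and h: "h \<le> d"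
  shows "q d (d - i) h = (if h = i then real w - 1 else 0) + (if h = d - i then real w - 2 else 0)"
proof -
  have id: "i \<le> d" "d - i \<le> d" using i by auto
  have TE: "fib x y * E i x y = (E i x y + E (d - i) x y) / w" for x y
    using fib_mult_E[OF id(1)] comb_cong[of "q d i" "\<lambda>h. if h = d - i then 1 else 0"] low
    by (simp add: comb_single1 id)
  have "comb (q d (d - i)) x y = comb (\<lambda>h. (if h = i then real w - 1 else 0) + (if h = d - i then real w - 2 else 0)) x y" for x y
  proof -
    have "fib x y * (E i x y + E (d - i) x y) = E i x y + E (d - i) x y"
      by (rule fib_fixes_image[OF TE])
    then have "fib x y * E (d - i) x y = (1 - 1 / w) * (E i x y + E (d - i) x y)"
      using TE[of x y] by (simp add: algebra_simps add_divide_distrib)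
    then have "E (d - i) x y + comb (q d (d - i)) x y = (real w - 1) * (E i x y + E (d - i) x y)"
      using fib_mult_E[OF id(2), of x y] w_pos by (simp add: field_simps)
    then show ?thesis by (simp add: comb_two id algebra_simps)
  qed
  then show ?thesis using comb_eqD h by blast
qed

text \<open>Multiplication by the fibre matrix is a self-adjoint idempotent, and its block structure
  makes it preserve squares of block-diagonal matrices; this pins down the one coefficient of
  \<open>E\<^sub>d \<circ> E\<^sub>j\<close> that the triangle conditions and the smaller indices leave undetermined.\<close>

lemma krein_d:
  assumes "2 * j \<le> d" "h \<le> d"
  shows "q d j h = (if h = d - j then if 2 * j < d then 1 else real w - 1 else 0)"
  using assms
proof (induction j arbitrary: h rule: less_induct)
  case (less j)
  define g where "g = q d j (d - j)"
  have jd: "j \<le> d" "d - j \<le> d" using less.prems by auto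
  \<comment> \<open>An index below \<open>d - j\<close> violates the triangle condition for
    \<open>d\<close> and \<open>j\<close>. One above has the form \<open>d - i\<close> with
    \<open>i < j\<close>, where the induction hypothesis and \<open>krein_d_high\<close>
    apply.\<close>
  have off: "q d j h = 0" if h: "h \<le> d" "h \<noteq> d - j" for h
  proof (cases "h < d - j")
    case True
    then show ?thesis using krein_vanish[of d j h] h jd by auto
  next
    case False
    define i where "i = d - h"
    have i: "i < j" "2 * i < d" "h = d - i" using False h less.prems jd by (auto simp: i_def)
    have "q d (d - i) j = 0"
      using krein_d_high[of i j] less.IH[of i] i less.prems jd by auto
    then show ?thesis using krein_rotate[of d j h] mult_pos[of h] i jd h by simp
  qed
  \<comment> \<open>By exchange of indices, \<open>g\<close> is a positive multiple of the top
    parameter \<open>q j (d - j) d\<close>.\<close>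
  have g_pos: "g > 0"
  proof -
    have "mult (d - j) * g = mult d * q j (d - j) d"
      using krein_triple[of d j "d - j"] krein_triple[of j "d - j" d] jd by (simp add: g_def mult_ac)
    also have "\<dots> > 0" using krein_top_pos[of j "d - j"] mult_pos[of d] jd by simp
    finally show ?thesis using mult_pos[of "d - j"] jd by (simp add: zero_less_mult_iff)
  qed
  have "comb (q d j) = comb (\<lambda>h. if h = d - j then g else 0)"
    using off by (intro comb_cong) (auto simp: g_def)
  then have TE: "fib x y * E j x y = (E j x y + g * E (d - j) x y) / w" for x y
    using fib_mult_E[OF jd(1)] by (simp add: comb_single jd)
  have "g = (if 2 * j < d then 1 else real w - 1)"
  proof (cases "2 * j < d")
    case False
    then have dj: "d - j = j" using less.prems by simp
    obtain x y where xy: "E j x y \<noteq> 0" using E_nonzero[OF jd(1)] by (auto simp: mat_zero_def fun_eq_iff)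
    \<comment> \<open>In the middle case \<open>d - j = j\<close>, so at a nonzero entry of
      \<open>E j\<close> the 0/1 matrix has the entry \<open>(1 + g) / w\<close>, which
      \<open>g > 0\<close> forces to be 1.\<close>
    have "E j x y * fib x y = E j x y * ((1 + g) / w)" using TE[of x y] by (simp add: dj algebra_simps)
    then have "fib x y = (1 + g) / w" using mult_left_cancel[OF xy] by blast
    moreover have "fib x y = 0 \<or> fib x y = 1" by (simp add: adj_def)
    ultimately have "1 + g = w" using g_pos w_pos by (auto simp: field_simps)
    then show ?thesis using False by simp
  next
    case True
    \<comment> \<open>\<open>W\<close> is a multiple of the image of \<open>E j\<close>, thus block
      diagonal, and so is its square. Unless \<open>g\<close> is 1, the two together separate
      \<open>E j\<close> from \<open>E (d - j)\<close> and make both block diagonal, against the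
      nonzero coefficient \<open>g\<close> in \<open>TE\<close>.\<close>
    define W where "W = comb (\<lambda>h. (if h = j then 1 else 0) + (if h = d - j then g else 0))"
    have W: "W x y = E j x y + g * E (d - j) x y" for x y by (simp add: W_def comb_two jd)
    have fW: "fib x y * W x y = W x y" for x y
      unfolding W by (rule fib_fixes_image[OF TE])
    have WW: "mat_mult X W W x y = E j x y + g\<^sup>2 * E (d - j) x y" for x y
    proof -
      have "mat_mult X W W = comb (\<lambda>h. (if h = j then 1 else 0) + (if h = d - j then g\<^sup>2 else 0))"
        unfolding W_def comb_mult using True by (intro comb_cong) (auto simp: power2_eq_square)
      then show ?thesis by (simp add: comb_two jd)
    qed
    have fWW: "fib x y * mat_mult X W W x y = mat_mult X W W x y" for x y
    proof -
      have "fib x y * (W x z * W z y) = W x z * W z y" for z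
      proof (cases "fib x z = 0 \<or> fib z y = 0")
        case True
        then show ?thesis using fW[of x z] fW[of z y] by auto
      next
        case False
        then have "(x, y) \<in> fibre_rel X d E"
          using equiv_fibre by (auto simp: adj_def equiv_def dest: transD)
        then show ?thesis by (simp add: adj_def)
      qed
      then show ?thesis by (simp only: mat_mult_def sum_distrib_left)
    qed
    have "g = 1"
    proof (rule ccontr)
      assume "g \<noteq> 1"
      have fd: "fib x y * E (d - j) x y = E (d - j) x y" for x y
      proof -
        have "(g\<^sup>2 - g) * (fib x y * E (d - j) x y) = (g\<^sup>2 - g) * E (d - j) x y"
          using fW[of x y] fWW[of x y] by (simp add: W WW algebra_simps)
        then show ?thesis using g_pos \<open>g \<noteq> 1\<close> by (simp add: power2_eq_square)
      qed
      have "fib x y * E j x y = E j x y" for x y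
      proof -
        have "fib x y * E j x y = fib x y * W x y - g * (fib x y * E (d - j) x y)"
          by (simp add: W algebra_simps)
        also have "\<dots> = E j x y" by (simp only: fW fd) (simp add: W)
        finally show ?thesis .
      qed
      then have "comb (\<lambda>h. (if h = j then 1 else 0) + (if h = d - j then g else 0)) =
          comb (\<lambda>h. (if h = j then real w else 0) + (if h = d - j then 0 else 0))"
        using TE w_pos by (intro ext, simp only: comb_two jd) (simp add: field_simps)
      from comb_eqD[OF this, of "d - j"] show False using True g_pos by (simp split: if_splits)
    qed
    then show ?thesis using True by simp
  qed
  then show ?case using off less.prems by (auto simp: g_def)
qed

lemma fib_low:
  assumes "2 * j < d"
  shows "fib x y * E j x y = (E j x y + E (d - j) x y) / w"
proof -
  have "comb (q d j) = comb (\<lambda>h. if h = d - j then 1 else 0)"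
    using krein_d[of j] assms by (intro comb_cong) auto
  then show ?thesis using fib_mult_E[of j] assms by (simp add: comb_single1)
qed

lemma fib_mid:
  assumes "2 * j = d"
  shows "fib x y * E j x y = E j x y"
proof -
  have "comb (q d j) = comb (\<lambda>h. if h = j then real w - 1 else 0)"
    using krein_d[of j] assms by (intro comb_cong) auto
  then show ?thesis using fib_mult_E[of j] assms w_pos by (simp add: comb_single field_simps)
qed

lemma fib_pair:
  assumes "2 * j < d"
  shows "fib x y * (E j x y + E (d - j) x y) = E j x y + E (d - j) x y"
  by (rule fib_fixes_image[OF fib_low[OF assms]])

lemma fib_diag: "x \<in> X \<Longrightarrow> fib x x = 1"
  using equiv_fibre by (auto simp: adj_def equiv_def refl_on_def)

text \<open>Compare diagonals in \<open>fib_low\<close>; the diagonal of the fibre matrix is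
  1.\<close>

lemma mult_high:
  assumes "2 * j < d"
  shows "mult (d - j) = (real w - 1) * mult j"
proof -
  have "w * E j x x = E j x x + E (d - j) x x" if "x \<in> X" for x
    using fib_low[OF assms, of x x] fib_diag[OF that] w_pos by (simp add: field_simps)
  then have "(\<Sum>x\<in>X. w * E j x x) = (\<Sum>x\<in>X. E j x x + E (d - j) x x)" by simp
  then show ?thesis by (simp add: mult_def sum.distrib sum_distrib_left[symmetric] algebra_simps)
qed

text \<open>Moving the fibre matrix to the other side of the Frobenius product gives
  \<open>w * f i * mult i = f i * mult i + f (d - i) * mult (d - i)\<close> for
  \<open>2 * i < d\<close>, and \<open>mult_high\<close> turns this into the symmetry.\<close>

lemma block_diagonal_symmetric:
  assumes "\<And>x y. fib x y * comb f x y = comb f x y" "h \<le> d"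
  shows "f (d - h) = f h"
proof -
  have low: "f (d - i) = f i" if i: "2 * i < d" for i
  proof -
    have id: "i \<le> d" "d - i \<le> d" using i by auto
    have "w * (comb f x y * E i x y) = comb f x y * E i x y + comb f x y * E (d - i) x y" for x y
    proof -
      have "comb f x y * E i x y = comb f x y * (fib x y * E i x y)"
        using assms(1)[of x y] by (metis mult.assoc mult.commute)
      then have "w * (comb f x y * E i x y) = w * (comb f x y * ((E i x y + E (d - i) x y) / w))"
        by (simp only: fib_low[OF i])
      also have "\<dots> = comb f x y * (E i x y + E (d - i) x y)" using w_pos by simp
      finally show ?thesis by (simp add: distrib_left)
    qed
    then have "w * (\<Sum>x\<in>X. \<Sum>y\<in>X. comb f x y * E i x y) =
        (\<Sum>x\<in>X. \<Sum>y\<in>X. comb f x y * E i x y) + (\<Sum>x\<in>X. \<Sum>y\<in>X. comb f x y * E (d - i) x y)"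
      by (simp add: sum_distrib_left sum.distrib)
    then have "w * (f i * mult i) = f i * mult i + f (d - i) * ((real w - 1) * mult i)"
      by (simp only: comb_inner id mult_high[OF i])
    then have "(real w - 1) * mult i * (f i - f (d - i)) = 0" by (simp add: algebra_simps)
    then show ?thesis using mult_pos[OF id(1)] w_ge by simp
  qed
  consider "2 * h < d" | "2 * h = d" | "2 * (d - h) < d" using assms(2) by linarith
  then show ?thesis
  proof cases
    case 2
    then have "d - h = h" by linarith
    then show ?thesis by simp
  next
    case 3
    then show ?thesis using low[of "d - h"] assms(2) by simp
  qed (use low in auto)
qed

text \<open>The squared Frobenius norm of the difference of both sides, expanded, is
  \<open>m\<^sub>j / w\<^sup>2 - 2 m\<^sub>j / w\<^sup>2 + m\<^sub>j / w\<^sup>2 = 0\<close>.\<close>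

lemma E_mult_over_fibre:
  assumes j: "2 * j < d" and V: "V \<in> fibres X d E"
  shows "(\<Sum>z\<in>V. E j x z * E j z y) = E j x y / w"
proof -
  let ?e = "E j"
  have jd: "j \<le> d" "d - j \<le> d" using j by auto
  have VX: "V \<subseteq> X" using V Union_quotient[OF equiv_fibre] by (auto simp: fibres_def)
  have same: "fib z u = 1" if "z \<in> V" "u \<in> V" for z u
    using that V quotient_eq_iff[OF equiv_fibre, of V V z u] by (auto simp: fibres_def adj_def)
  have closed: "u \<in> V" if "z \<in> V" "fib z u \<noteq> 0" for z u
    using that V in_quotient_imp_closed[OF equiv_fibre, of V z u] by (auto simp: fibres_def adj_def)
  have sq: "(\<Sum>z\<in>X. ?e x z * ?e z y) = ?e x y" for x y using E_mult_apply[of j j] jd by simp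
  have trV: "(\<Sum>z\<in>V. ?e z z) = mult j / w"
  proof -
    have "(\<Sum>z\<in>V. ?e z z) = (\<Sum>z\<in>V. mult j / card X)"
      using VX E_diag[OF jd(1)] by (intro sum.cong) auto
    then show ?thesis using card_fibre[OF V] n_pos w_pos by (simp add: card_X field_simps)
  qed
  define S where "S x y = (\<Sum>z\<in>V. ?e x z * ?e z y)" for x y
  \<comment> \<open>Symmetry of \<open>E j\<close> rearranges the four factors so that the sums over
    \<open>x\<close> and over \<open>y\<close> each become an entry of the square of
    \<open>E j\<close>.\<close>
  have regroup: "(?e x z * ?e z y) * (?e x u * ?e u y) = (?e z x * ?e x u) * (?e z y * ?e y u)" for x y z u
    using E_sym[OF jd(1), of x z] E_sym[OF jd(1), of u y] by simp
  have t1: "(\<Sum>x\<in>X. \<Sum>y\<in>X. S x y * S x y) = mult j / w\<^sup>2"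
  proof -
    have "(\<Sum>x\<in>X. \<Sum>y\<in>X. S x y * S x y) =
        (\<Sum>z\<in>V. \<Sum>u\<in>V. \<Sum>x\<in>X. \<Sum>y\<in>X. (?e x z * ?e z y) * (?e x u * ?e u y))"
      unfolding S_def sum_product
      by (simp only: sum.swap[of _ V X])
    also have "\<dots> = (\<Sum>z\<in>V. \<Sum>u\<in>V. (\<Sum>x\<in>X. ?e z x * ?e x u) * (\<Sum>y\<in>X. ?e z y * ?e y u))"
      unfolding sum_product by (simp only: regroup)
    also have "\<dots> = (\<Sum>z\<in>V. \<Sum>u\<in>V. ?e z u * ?e z u)" by (simp only: sq)
    also have "\<dots> = (\<Sum>z\<in>V. ?e z z / w)"
    proof (rule sum.cong[OF refl])
      fix z assume z: "z \<in> V"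
      \<comment> \<open>Row \<open>z\<close> of the block-diagonal idempotent
        \<open>E j + E (d - j)\<close>. It vanishes outside \<open>V\<close> and is \<open>w\<close>
        times row \<open>z\<close> of \<open>E j\<close> on \<open>V\<close>, so the sum over
        \<open>V\<close> extends to \<open>X\<close>, where idempotency applies.\<close>
      define F where "F u = ?e z u + E (d - j) z u" for u
      have F0: "F u = 0" if "u \<notin> V" for u
        using fib_pair[OF j, of z u] closed[OF z, of u] that by (auto simp: F_def)
      have eF: "?e z u = F u / w" if "u \<in> V" for u
        using fib_low[OF j, of z u] same[OF z that] by (simp add: F_def)
      have "(\<Sum>u\<in>V. ?e z u * ?e z u) = (\<Sum>u\<in>V. F u * F u) / w\<^sup>2"
        by (simp add: eF power2_eq_square sum_divide_distrib)
      also have "(\<Sum>u\<in>V. F u * F u) = (\<Sum>u\<in>X. F u * F u)"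
        using VX F0 finite_X by (intro sum.mono_neutral_left) auto
      also have "\<dots> = (\<Sum>u\<in>X. ?e z u * ?e u z) + (\<Sum>u\<in>X. ?e z u * E (d - j) u z)
          + (\<Sum>u\<in>X. E (d - j) z u * ?e u z) + (\<Sum>u\<in>X. E (d - j) z u * E (d - j) u z)"
        by (simp add: F_def algebra_simps sum.distrib[symmetric] E_sym[OF jd(1), of _ z] E_sym[OF jd(2), of _ z])
      also have "\<dots> = F z"
      proof -
        have "d - j \<noteq> j" using j by linarith
        then show ?thesis using jd by (simp add: E_mult_apply F_def)
      qed
      finally show "(\<Sum>u\<in>V. ?e z u * ?e z u) = ?e z z / w"
        using eF[OF z] w_pos by (simp add: power2_eq_square)
    qed
    also have "\<dots> = mult j / w\<^sup>2" using trV by (simp add: sum_divide_distrib[symmetric] power2_eq_square)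
    finally show ?thesis .
  qed
  have t2: "(\<Sum>x\<in>X. \<Sum>y\<in>X. S x y * ?e x y) = mult j / w"
  proof -
    have "(\<Sum>x\<in>X. \<Sum>y\<in>X. S x y * ?e x y) = (\<Sum>z\<in>V. \<Sum>x\<in>X. \<Sum>y\<in>X. ?e z x * (?e x y * ?e y z))"
      unfolding S_def sum_distrib_right
      by (simp only: sum.swap[of _ V X]) (simp add: mult_ac E_sym[OF jd(1)])
    also have "\<dots> = (\<Sum>z\<in>V. \<Sum>x\<in>X. ?e z x * ?e x z)"
      by (simp only: sum_distrib_left[symmetric] sq)
    finally show ?thesis using trV by (simp add: sq)
  qed
  have "(\<Sum>x\<in>X. \<Sum>y\<in>X. (S x y - ?e x y / w)\<^sup>2) =
      (\<Sum>x\<in>X. \<Sum>y\<in>X. S x y * S x y) - 2 / w * (\<Sum>x\<in>X. \<Sum>y\<in>X. S x y * ?e x y)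
      + 1 / w\<^sup>2 * (\<Sum>x\<in>X. \<Sum>y\<in>X. ?e x y * ?e x y)"
    by (simp add: sum_distrib_left sum.distrib[symmetric] sum_subtractf[symmetric] power2_eq_square
        algebra_simps)
  also have "\<dots> = 0" using t1 t2 E_inner[of j j] jd by (simp add: power2_eq_square)
  finally have zero: "(\<Sum>x\<in>X. \<Sum>y\<in>X. (S x y - ?e x y / w)\<^sup>2) = 0" .
  have "S x y = ?e x y / w"
  proof (cases "x \<in> X \<and> y \<in> X")
    case True
    have "0 \<le> (\<Sum>y\<in>X. (S x y - ?e x y / w)\<^sup>2)" for x by (intro sum_nonneg) simp
    then have "(\<Sum>y\<in>X. (S x y - ?e x y / w)\<^sup>2) = 0"
      using zero True sum_nonneg_eq_0_iff[OF finite_X, of "\<lambda>x. \<Sum>y\<in>X. (S x y - ?e x y / w)\<^sup>2"]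
      by blast
    then have "(S x y - ?e x y / w)\<^sup>2 = 0"
      using True finite_X sum_nonneg_eq_0_iff[of X "\<lambda>y. (S x y - ?e x y / w)\<^sup>2"] by auto
    then show ?thesis by simp
  next
    case False
    then have "?e x z * ?e z y = 0" for z using E_outside[OF jd(1)] by auto
    then have "S x y = 0" unfolding S_def by (intro sum.neutral) blast
    then show ?thesis using E_outside[OF jd(1), of x y] False by auto
  qed
  then show ?thesis by (simp add: S_def)
qed

end

section \<open>Restriction to a union of fibres\<close>

text \<open>The last sum is empty for odd \<open>d\<close> and has one term for even
  \<open>d\<close>.\<close>

lemma sum_reflected_pairs:
  fixes f :: "nat \<Rightarrow> real"
  shows "(\<Sum>h=0..d. f h) = (\<Sum>h | 2 * h < d. f h + f (d - h)) + (\<Sum>h | 2 * h = d. f h)"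
proof -
  have fin: "finite {h. 2 * h < d}" "finite {h. 2 * h = d}" "finite {h. h \<le> d \<and> d < 2 * h}"
    by (auto intro: finite_subset[of _ "{..d}"])
  have "{0..d} = ({h. 2 * h < d} \<union> {h. h \<le> d \<and> d < 2 * h}) \<union> {h. 2 * h = d}" by auto
  then have "(\<Sum>h=0..d. f h) = (\<Sum>h | 2 * h < d. f h) + (\<Sum>h | h \<le> d \<and> d < 2 * h. f h) + (\<Sum>h | 2 * h = d. f h)"
    using fin by (simp add: sum.union_disjoint disjoint_iff)
  moreover have "(\<Sum>h | h \<le> d \<and> d < 2 * h. f h) = (\<Sum>h | 2 * h < d. f (d - h))"
    by (rule sum.reindex_bij_witness[of _ "\<lambda>h. d - h" "\<lambda>h. d - h"]) auto
  ultimately show ?thesis by (simp add: sum.distrib)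
qed

locale dismantled_scheme = Q_antipodal_scheme X \<R> d E n w
  for X :: "'a set" and \<R> :: "('a \<times> 'a) set set" and d :: nat and E :: "nat \<Rightarrow> 'a sqmat" and n w :: nat +
  fixes \<F> :: "'a set set" and w' :: nat and Y :: "'a set"
  assumes fibres_sub: "\<F> \<subseteq> fibres X d E" and card_F: "card \<F> = w'" and w'_ge: "w' \<ge> 2"
    and Y_def: "Y = \<Union>\<F>"
begin

text \<open>The ratio of the sizes of \<open>X\<close> and \<open>Y\<close>, as all fibres are
  equally large.\<close>

definition t :: real where "t = real w / real w'"

text \<open>Restriction to \<open>Y\<close>, padded with zeros because matrices over
  \<open>Y\<close> keep the index type of \<open>X\<close>.\<close>

definition rho :: "'a sqmat \<Rightarrow> 'a sqmat" where
  "rho M = (\<lambda>x y. if x \<in> Y \<and> y \<in> Y then M x y else 0)"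

lemma w'_pos: "real w' > 0" using w'_ge by simp

lemma t_pos: "t > 0" using w_pos w'_pos by (simp add: t_def)

lemma t_less: "t < w"
  using w_pos w'_ge by (simp add: t_def field_simps)

lemma Y_sub: "Y \<subseteq> X"
  using fibres_sub Union_quotient[OF equiv_fibre] by (auto simp: Y_def fibres_def)

lemma finite_Y: "finite Y" using Y_sub finite_X finite_subset by blast

lemma card_Y: "real (card Y) = real n * real w'"
  using card_Union_fibres[OF fibres_sub] card_F by (simp add: Y_def)

lemma card_X_eq: "real (card X) = t * real (card Y)"
  using w'_pos by (simp add: card_X card_Y t_def)

lemma Y_nonempty: "Y \<noteq> {}"
  using card_Y n_pos w'_pos by auto

lemma Y_closed:
  assumes "fib x z \<noteq> 0"
  shows "x \<in> Y \<longleftrightarrow> z \<in> Y"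
proof -
  have xz: "(x, z) \<in> fibre_rel X d E" "(z, x) \<in> fibre_rel X d E"
    using assms equiv_fibre by (auto simp: adj_def equiv_def dest: symD)
  then show ?thesis
    using fibres_sub in_quotient_imp_closed[OF equiv_fibre] unfolding Y_def fibres_def by blast
qed

text \<open>For \<open>x\<close> in \<open>Y\<close>, row \<open>x\<close> of a block-diagonal
  \<open>F\<close> is supported in \<open>Y\<close>, so summing over \<open>Y\<close> loses nothing.
  With \<open>rho_mult_right\<close>, restriction is multiplicative as soon as one factor is block
  diagonal.\<close>

lemma rho_mult_left:
  assumes "\<And>x y. fib x y * F x y = F x y"
  shows "mat_mult Y (rho F) (rho M) = rho (mat_mult X F M)"
proof (intro ext)
  fix x y
  show "mat_mult Y (rho F) (rho M) x y = rho (mat_mult X F M) x y"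
  proof (cases "x \<in> Y \<and> y \<in> Y")
    case True
    have "F x z = 0" if "z \<notin> Y" for z using that assms[of x z] Y_closed[of x z] True by auto
    then have "(\<Sum>z\<in>Y. F x z * M z y) = (\<Sum>z\<in>X. F x z * M z y)"
      using Y_sub finite_X by (intro sum.mono_neutral_left) auto
    then show ?thesis using True by (simp add: mat_mult_def rho_def)
  qed (auto simp: mat_mult_def rho_def)
qed

lemma rho_mult_right:
  assumes "\<And>x y. fib x y * F x y = F x y"
  shows "mat_mult Y (rho M) (rho F) = rho (mat_mult X M F)"
proof (intro ext)
  fix x y
  show "mat_mult Y (rho M) (rho F) x y = rho (mat_mult X M F) x y"
  proof (cases "x \<in> Y \<and> y \<in> Y")
    case True
    have "F z y = 0" if "z \<notin> Y" for z using that assms[of z y] Y_closed[of z y] True by auto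
    then have "(\<Sum>z\<in>Y. M x z * F z y) = (\<Sum>z\<in>X. M x z * F z y)"
      using Y_sub finite_X by (intro sum.mono_neutral_left) auto
    then show ?thesis using True by (simp add: mat_mult_def rho_def)
  qed (auto simp: mat_mult_def rho_def)
qed

lemma E_mult_over_Y:
  assumes "2 * j < d"
  shows "(\<Sum>z\<in>Y. E j x z * E j z y) = E j x y / t"
proof -
  have "(\<Sum>z\<in>Y. E j x z * E j z y) = (\<Sum>V\<in>\<F>. \<Sum>z\<in>V. E j x z * E j z y)"
    unfolding Y_def
  proof (rule sum.Union_disjoint[unfolded comp_def])
    have "V \<subseteq> Y" if "V \<in> \<F>" for V using that by (auto simp: Y_def)
    then show "\<forall>V\<in>\<F>. finite V" using finite_Y finite_subset by blast
    show "\<forall>U\<in>\<F>. \<forall>V\<in>\<F>. U \<noteq> V \<longrightarrow> U \<inter> V = {}"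
      using fibres_sub quotient_disj[OF equiv_fibre] unfolding fibres_def by blast
  qed
  also have "\<dots> = (\<Sum>V\<in>\<F>. E j x y / w)"
    using fibres_sub E_mult_over_fibre[OF assms] by (intro sum.cong) auto
  finally show ?thesis using card_F w_pos by (simp add: t_def)
qed

text \<open>For \<open>2 j < d\<close> the pair \<open>E\<^sub>j + E\<^sub>d\<^sub>-\<^sub>j\<close> is block diagonal, so its restriction is idempotent; it
  splits into the rescaled restriction of \<open>E\<^sub>j\<close> and the complement.\<close>

definition coef :: "nat \<Rightarrow> nat \<Rightarrow> real" where
  "coef j h = (if 2 * j < d then if h = j then t else 0
     else if h = j then 1 else if h = d - j then 1 - t else 0)"

definition E' :: "nat \<Rightarrow> 'a sqmat" where
  "E' j = rho (comb (coef j))"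

text \<open>The indices \<open>j\<close> and \<open>d - j\<close> are taken as a set, so that for
  \<open>2 * j = d\<close> this is \<open>E j\<close> rather than its double.\<close>

definition G :: "nat \<Rightarrow> 'a sqmat" where
  "G j = comb (\<lambda>h. if h = j \<or> h = d - j then 1 else 0)"

lemma E'_low:
  assumes "2 * j < d"
  shows "E' j = (\<lambda>x y. t * rho (E j) x y)"
proof -
  have "comb (coef j) = comb (\<lambda>h. if h = j then t else 0)"
    using assms by (intro comb_cong) (auto simp: coef_def)
  then show ?thesis using assms by (auto simp: E'_def comb_single rho_def fun_eq_iff)
qed

lemma E'_mid:
  assumes "2 * j = d"
  shows "E' j = rho (E j)"
proof -
  have "comb (coef j) = comb (\<lambda>h. if h = j then 1 else 0)"
    using assms by (intro comb_cong) (auto simp: coef_def)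
  then show ?thesis using assms by (simp add: E'_def comb_single1)
qed

lemma G_pair:
  assumes "2 * j < d"
  shows "G j = (\<lambda>x y. E j x y + E (d - j) x y)"
proof -
  have "G j = comb (\<lambda>h. (if h = j then 1 else 0) + (if h = d - j then 1 else 0))"
    unfolding G_def using assms by (intro comb_cong) auto
  then show ?thesis using assms by (simp add: fun_eq_iff comb_two)
qed

lemma G_mid:
  assumes "2 * j = d"
  shows "G j = E j"
proof -
  have "G j = comb (\<lambda>h. if h = j then 1 else 0)"
    unfolding G_def using assms by (intro comb_cong) auto
  then show ?thesis using assms by (simp add: comb_single1)
qed

lemma G_reflect: "j \<le> d \<Longrightarrow> G (d - j) = G j"
  unfolding G_def by (intro comb_cong) auto

lemma G_block:
  assumes "j \<le> d"
  shows "fib x y * G j x y = G j x y"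
proof -
  consider "2 * j < d" | "2 * j = d" | "2 * (d - j) < d" using assms by linarith
  then show ?thesis
  proof cases
    case 3
    have "fib x y * G (d - j) x y = G (d - j) x y" using fib_pair[OF 3] by (simp add: G_pair[OF 3])
    then show ?thesis using G_reflect[OF assms] by simp
  qed (use fib_pair fib_mid in \<open>auto simp: G_pair G_mid\<close>)
qed

lemma E'_high:
  assumes "2 * j < d"
  shows "E' (d - j) = (\<lambda>x y. rho (G j) x y - E' j x y)"
proof -
  have "comb (coef (d - j)) = comb (\<lambda>h. (if h = j \<or> h = d - j then 1 else 0) - coef j h)"
    using assms by (intro comb_cong) (auto simp: coef_def)
  then show ?thesis by (auto simp: E'_def G_def rho_def comb_diff fun_eq_iff)
qed

lemma rho_zero: "rho mat_zero = mat_zero"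
  by (auto simp: rho_def mat_zero_def fun_eq_iff)

text \<open>\<open>G i\<close> is block diagonal, so the product may be taken before restricting,
  where it keeps the coordinates \<open>i\<close> and \<open>d - i\<close> and kills the
  others.\<close>

lemma G_E':
  assumes "i \<le> d" "j \<le> d"
  shows "mat_mult Y (rho (G i)) (E' j) = (if i = j \<or> i = d - j then E' j else mat_zero)"
proof -
  have "mat_mult Y (rho (G i)) (E' j) = rho (comb (\<lambda>h. (if h = i \<or> h = d - i then 1 else 0) * coef j h))"
    unfolding E'_def rho_mult_left[OF G_block[OF assms(1)]] by (simp add: G_def comb_mult)
  also have "\<dots> = (if i = j \<or> i = d - j then E' j else rho (comb (\<lambda>h. 0)))"
  proof (cases "i = j \<or> i = d - j")
    case True
    then show ?thesis unfolding E'_def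
      using assms by (auto simp: coef_def intro!: arg_cong[of _ _ rho] comb_cong)
  next
    case False
    then have "comb (\<lambda>h. (if h = i \<or> h = d - i then 1 else 0) * coef j h) = comb (\<lambda>h. 0)"
      using assms by (intro comb_cong) (auto simp: coef_def)
    then show ?thesis using False by simp
  qed
  finally show ?thesis by (simp add: comb_zero rho_zero)
qed

lemma E'_G:
  assumes "j \<le> d"
  shows "mat_mult Y (E' j) (rho (G j)) = E' j"
proof -
  have "mat_mult Y (E' j) (rho (G j)) = rho (comb (\<lambda>h. coef j h * (if h = j \<or> h = d - j then 1 else 0)))"
    unfolding E'_def rho_mult_right[OF G_block[OF assms]] by (simp add: G_def comb_mult)
  also have "comb (\<lambda>h. coef j h * (if h = j \<or> h = d - j then 1 else 0)) = comb (coef j)"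
    by (intro comb_cong) (auto simp: coef_def)
  finally show ?thesis by (simp add: E'_def)
qed

lemma G_idem:
  assumes "j \<le> d"
  shows "mat_mult Y (rho (G j)) (rho (G j)) = rho (G j)"
proof -
  have "mat_mult X (G j) (G j) = G j" unfolding G_def comb_mult by (intro comb_cong) auto
  then show ?thesis using rho_mult_left[OF G_block[OF assms]] by simp
qed

text \<open>\<open>E j\<close> is not block diagonal, so \<open>rho_mult_left\<close> does not
  apply. Instead the sum over \<open>Y\<close> contributes \<open>1 / t\<close>, which the rescaling
  by \<open>t\<close> absorbs.\<close>

lemma E'_low_idem:
  assumes "2 * j < d"
  shows "mat_mult Y (E' j) (E' j) = E' j"
proof (intro ext)
  fix x y
  show "mat_mult Y (E' j) (E' j) x y = E' j x y"
  proof (cases "x \<in> Y \<and> y \<in> Y")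
    case True
    then have "mat_mult Y (E' j) (E' j) x y = (\<Sum>z\<in>Y. t * t * (E j x z * E j z y))"
      by (simp add: mat_mult_def E'_low[OF assms] rho_def mult_ac)
    also have "\<dots> = t * t * (E j x y / t)"
      by (simp only: sum_distrib_left[symmetric] E_mult_over_Y[OF assms])
    finally show ?thesis using True t_pos by (simp add: E'_low[OF assms] rho_def)
  qed (auto simp: mat_mult_def E'_low[OF assms] rho_def)
qed

text \<open>Across different pairs, inserting the unit \<open>rho (G i)\<close> gives zero. Within a
  pair, \<open>E' k\<close> is an idempotent below \<open>rho (G k)\<close>, and its complement
  there is orthogonal to it.\<close>

lemma E'_mult:
  assumes ij: "i \<le> d" "j \<le> d"
  shows "mat_mult Y (E' i) (E' j) = (if i = j then E' i else mat_zero)"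
proof (cases "i = j \<or> i = d - j")
  case False
  have "mat_mult Y (E' i) (E' j) = mat_mult Y (mat_mult Y (E' i) (rho (G i))) (E' j)"
    by (simp add: E'_G ij)
  also have "\<dots> = mat_mult Y (E' i) mat_zero" using False by (simp add: mat_mult_assoc G_E' ij)
  finally show ?thesis using False by (simp add: mat_mult_zero_right)
next
  case True
  have low: "mat_mult Y (E' k) (E' k) = E' k \<and> mat_mult Y (E' k) (E' (d - k)) = mat_zero \<and>
      mat_mult Y (E' (d - k)) (E' k) = mat_zero \<and> mat_mult Y (E' (d - k)) (E' (d - k)) = E' (d - k)"
    if k: "2 * k < d" for k
  proof -
    have "mat_mult Y (rho (G k)) (E' k) = E' k" "mat_mult Y (E' k) (rho (G k)) = E' k"
      "mat_mult Y (rho (G k)) (rho (G k)) = rho (G k)"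
      using G_E'[of k k] E'_G[of k] G_idem[of k] k by auto
    then show ?thesis
      by (simp add: E'_high[OF k] mat_mult_diff_left mat_mult_diff_right E'_low_idem[OF k] mat_zero_def)
  qed
  consider "2 * j < d" | "2 * j = d" | "2 * (d - j) < d" using ij by linarith
  then show ?thesis
  proof cases
    case 1
    then have "d - j \<noteq> j" by linarith
    then show ?thesis using low[OF 1] True by auto
  next
    case 2
    then have "i = j" using True by auto
    moreover have "mat_mult Y (E' j) (E' j) = E' j" using E'_G[OF ij(2)] by (simp add: E'_mid[OF 2] G_mid[OF 2])
    ultimately show ?thesis by simp
  next
    case 3
    have "d - (d - j) = j" "d - j \<noteq> j" using ij 3 by auto
    then show ?thesis using low[OF 3] True by auto
  qed
qed

lemma E'_nonzero:
  assumes "j \<le> d"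
  shows "E' j \<noteq> mat_zero"
proof -
  obtain x where x: "x \<in> Y" using Y_nonempty by blast
  then have xX: "x \<in> X" using Y_sub by blast
  have pos: "E h x x > 0" if "h \<le> d" for h
    using E_diag[OF that xX] mult_pos[OF that] card_pos by simp
  have "E' j x x \<noteq> 0"
  proof -
    consider "2 * j < d" | "2 * j = d" | "2 * (d - j) < d" using assms by linarith
    then show ?thesis
    proof cases
      case 1
      then show ?thesis using pos[OF assms] t_pos x by (simp add: E'_low rho_def)
    next
      case 2
      then show ?thesis using pos[OF assms] x by (simp add: E'_mid rho_def)
    next
      case 3
      \<comment> \<open>On the diagonal the pair sum is \<open>w * E (d - j)\<close>, from which
        \<open>t * E (d - j)\<close> is removed. The rest is nonzero because two or more fibres give
        \<open>t < w\<close>.\<close>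
      have "E' j x x = (w - t) * E (d - j) x x"
        using fib_low[OF 3, of x x] fib_diag[OF xX] w_pos E'_high[OF 3] x assms
        by (simp add: G_pair[OF 3] E'_low[OF 3] rho_def field_simps)
      then show ?thesis using t_less pos[of "d - j"] by simp
    qed
  qed
  then show ?thesis by (auto simp: mat_zero_def)
qed

section \<open>The dismantled relations as a scheme\<close>

abbreviation \<R>' where "\<R>' \<equiv> dismantled \<R> Y"

lemma partition_dismantled: "partition_on (Y \<times> Y) \<R>'"
proof (rule partition_onI)
  show "\<Union>\<R>' = Y \<times> Y"
  proof
    show "Y \<times> Y \<subseteq> \<Union>\<R>'"
    proof
      fix p assume p: "p \<in> Y \<times> Y"
      then have "p \<in> X \<times> X" using Y_sub by auto
      then obtain R where "R \<in> \<R>" "p \<in> R" using partition_onD1[OF part] by blast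
      then show "p \<in> \<Union>\<R>'" using p by (auto simp: dismantled_def)
    qed
  qed (auto simp: dismantled_def)
next
  fix p q assume "p \<in> \<R>'" "q \<in> \<R>'" "p \<noteq> q"
  then show "disjnt p q"
    using partition_onD2[OF part] by (auto simp: dismantled_def disjnt_def disjoint_def)
qed (auto simp: dismantled_def)

lemma rho_mem:
  assumes "M \<in> bose_mesner \<R>"
  shows "rho M \<in> bose_mesner \<R>'"
proof -
  have "finite \<R>'" using finite_elements[OF _ partition_dismantled] finite_Y by simp
  note iff = bose_mesner_iff[OF partition_dismantled this]
  show ?thesis
    unfolding iff
  proof (intro conjI allI impI ballI)
    fix x y assume "(x, y) \<notin> Y \<times> Y"
    then show "rho M x y = 0" by (auto simp: rho_def)
  next
    fix S assume "S \<in> \<R>'"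
    then obtain R where R: "R \<in> \<R>" "S = R \<inter> (Y \<times> Y)" by (auto simp: dismantled_def)
    then obtain x y where xy: "(x, y) \<in> R" using rel_nonempty by blast
    show "\<exists>k. \<forall>(x, y)\<in>S. rho M x y = k"
    proof (intro exI[of _ "M x y"], clarify)
      fix x' y' assume "(x', y') \<in> S"
      then show "rho M x' y' = M x y" using bm_const[OF assms R(1) _ xy] by (auto simp: R rho_def)
    qed
  qed
qed

text \<open>Each dismantled relation is the restriction of one of \<open>d + 1\<close> relations,
  which bounds their number; with the \<open>d + 1\<close> idempotents the general theory then
  yields the scheme.\<close>

sublocale dis: orthogonal_idempotents Y \<R>' d E'
proof
  show "Id_on Y \<in> \<R>'"
    unfolding dismantled_def using Id_mem Y_sub Y_nonempty by (intro CollectI exI[of _ "Id_on X"]) auto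
  show "sym R" if "R \<in> \<R>'" for R
    using that sym_rel by (auto simp: dismantled_def sym_def)
  have "\<R>' \<subseteq> (\<lambda>R. R \<inter> (Y \<times> Y)) ` \<R>" by (auto simp: dismantled_def)
  then have "card \<R>' \<le> card \<R>" using surj_card_le[OF finite_rels] by blast
  then show "card \<R>' \<le> Suc d" using card_rels by simp
  show "E' j \<in> bose_mesner \<R>'" for j unfolding E'_def by (rule rho_mem[OF comb_mem])
  have "E' 0 x y = 1 / real (card Y) * adj (Y \<times> Y) x y" for x y
    using d_ge t_pos Y_sub by (auto simp: E'_low rho_def E_0 adj_def card_X_eq)
  then show "E' 0 = (\<lambda>x y. 1 / real (card Y) * adj (Y \<times> Y) x y)" by blast
qed (use finite_Y Y_nonempty partition_dismantled E'_mult E'_nonzero in auto)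

text \<open>The change of coordinates from \<open>E\<close> to \<open>E'\<close>: for
  \<open>2 * h < d\<close> the restriction of \<open>E h\<close> is \<open>E' h / t\<close>, and
  that of \<open>E (d - h)\<close> is \<open>E' (d - h) + (1 - 1 / t) E' h\<close>.\<close>

definition res :: "(nat \<Rightarrow> real) \<Rightarrow> nat \<Rightarrow> real" where
  "res f h = (if 2 * h < d then f h / t + (1 - 1 / t) * f (d - h) else f h)"

lemma rho_comb: "rho (comb f) x y = dis.comb (res f) x y"
proof (cases "x \<in> Y \<and> y \<in> Y")
  case True
  have low: "res f h * E' h x y + res f (d - h) * E' (d - h) x y = f h * E h x y + f (d - h) * E (d - h) x y"
    if h: "2 * h < d" for h
  proof -
    have eqs: "res f h = f h / t + (1 - 1 / t) * f (d - h)" "res f (d - h) = f (d - h)"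
      "E' h x y = t * E h x y" "E' (d - h) x y = E h x y + E (d - h) x y - t * E h x y"
      using h True by (auto simp: res_def E'_high[OF h] E'_low[OF h] G_pair[OF h] rho_def)
    show ?thesis unfolding eqs using t_pos by (simp add: field_simps)
  qed
  have mid: "res f h * E' h x y = f h * E h x y" if "2 * h = d" for h
    using that True by (simp add: res_def E'_mid[OF that] rho_def)
  show ?thesis
    unfolding dis.comb_def sum_reflected_pairs[of _ d] using True
    by (simp add: low mid rho_def comb_def sum_reflected_pairs[of _ d])
qed (auto simp: rho_def dis.comb_def dis.E_outside)

lemma res_symmetric:
  assumes "\<And>h. h \<le> d \<Longrightarrow> f (d - h) = f h" "h \<le> d"
  shows "res f h = f h"
  using assms(1)[OF assms(2)] by (simp add: res_def algebra_simps)

text \<open>The entrywise product of \<open>E 1\<close> with a block-diagonal matrix is block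
  diagonal, so \<open>block_diagonal_symmetric\<close> applies.\<close>

lemma E_times_block_symmetric:
  assumes "j \<le> d" "h \<le> d"
  shows "2 * j = d \<Longrightarrow> q 1 j (d - h) = q 1 j h"
    and "2 * j < d \<Longrightarrow> q 1 j (d - h) + q 1 (d - j) (d - h) = q 1 j h + q 1 (d - j) h"
proof -
  have d1: "1 \<le> d" using d_ge by simp
  show "q 1 j (d - h) = q 1 j h" if j: "2 * j = d"
  proof (rule block_diagonal_symmetric[OF _ assms(2)])
    fix x y
    have "fib x y * comb (q 1 j) x y = real (card X) * E 1 x y * (fib x y * E j x y)"
      using E_times_E[OF d1 assms(1), of x y, symmetric] by simp
    also have "\<dots> = comb (q 1 j) x y"
      using E_times_E[OF d1 assms(1), of x y] by (simp only: fib_mid[OF j] mult.assoc)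
    finally show "fib x y * comb (q 1 j) x y = comb (q 1 j) x y" .
  qed
  show "q 1 j (d - h) + q 1 (d - j) (d - h) = q 1 j h + q 1 (d - j) h" if j: "2 * j < d"
  proof (rule block_diagonal_symmetric[OF _ assms(2), of "\<lambda>h. q 1 j h + q 1 (d - j) h"])
    fix x y
    have eq: "comb (\<lambda>h. q 1 j h + q 1 (d - j) h) x y = real (card X) * E 1 x y * (E j x y + E (d - j) x y)"
      using E_times_E[OF d1 assms(1), of x y] E_times_E[OF d1, of "d - j" x y]
      by (simp add: comb_add algebra_simps)
    have "fib x y * comb (\<lambda>h. q 1 j h + q 1 (d - j) h) x y =
        real (card X) * E 1 x y * (fib x y * (E j x y + E (d - j) x y))"
      unfolding eq by (simp only: mult_ac)
    then show "fib x y * comb (\<lambda>h. q 1 j h + q 1 (d - j) h) x y = comb (\<lambda>h. q 1 j h + q 1 (d - j) h) x y"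
      by (simp only: fib_pair[OF j] eq)
  qed
qed

section \<open>Krein parameters of the dismantled scheme\<close>

abbreviation q' :: "nat \<Rightarrow> nat \<Rightarrow> nat \<Rightarrow> real" where "q' \<equiv> krein Y d E'"

text \<open>As \<open>t * card Y\<close> equals \<open>card X\<close>, the rescaling of
  \<open>E' 1\<close> absorbs the change of size.\<close>

lemma E'_1_times:
  assumes "j \<le> d"
  shows "real (card Y) * (E' 1 x y * rho (E j) x y) = dis.comb (res (q 1 j)) x y"
proof -
  have "E' 1 x y = t * rho (E 1) x y" using d_ge by (simp add: E'_low)
  then have "real (card Y) * (E' 1 x y * rho (E j) x y) = rho (comb (q 1 j)) x y"
    using E_times_E[of 1 j x y] d_ge assms by (auto simp: rho_def card_X_eq mult_ac)
  then show ?thesis by (simp add: rho_comb)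
qed

lemma q'_low:
  assumes j: "2 * j < d" and h: "h \<le> d"
  shows "q' 1 j h = (if 2 * h < d then q 1 j h + (t - 1) * q 1 j (d - h) else t * q 1 j h)"
proof -
  have "q' 1 j h = t * res (q 1 j) h"
  proof (rule dis.krein_eqI)
    fix x y
    show "real (card Y) * (E' 1 x y * E' j x y) = dis.comb (\<lambda>h. t * res (q 1 j) h) x y"
      using E'_1_times[of j x y] j by (simp add: E'_low[OF j] dis.comb_scale mult_ac)
  qed (use j h d_ge in auto)
  then show ?thesis using t_pos by (simp add: res_def field_simps)
qed

lemma q'_mid:
  assumes j: "2 * j = d" and h: "h \<le> d"
  shows "q' 1 j h = q 1 j h"
proof -
  have "q' 1 j h = res (q 1 j) h"
    using E'_1_times[of j] j h d_ge by (intro dis.krein_eqI) (auto simp: E'_mid)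
  also have "\<dots> = q 1 j h" using E_times_block_symmetric(1)[of j] j h by (intro res_symmetric) auto
  finally show ?thesis .
qed

text \<open>\<open>E' (d - j)\<close> is the restricted pair minus \<open>E' j\<close>. The pair
  contributes symmetric coordinates, which \<open>res\<close> leaves unchanged.\<close>

lemma q'_high:
  assumes j: "2 * j < d" and h: "h \<le> d"
  shows "q' 1 (d - j) h = q 1 j h + q 1 (d - j) h - q' 1 j h"
proof -
  have res_add: "res (q 1 j) k + res (q 1 (d - j)) k = res (\<lambda>k. q 1 j k + q 1 (d - j) k) k" for k
    by (simp add: res_def algebra_simps add_divide_distrib)
  have "q' 1 (d - j) h = res (q 1 j) h + res (q 1 (d - j)) h - q' 1 j h"
  proof (rule dis.krein_eqI)
    fix x y
    have "rho (G j) x y = rho (E j) x y + rho (E (d - j)) x y" by (simp add: G_pair[OF j] rho_def)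
    then show "real (card Y) * (E' 1 x y * E' (d - j) x y) =
        dis.comb (\<lambda>h. res (q 1 j) h + res (q 1 (d - j)) h - q' 1 j h) x y"
      using E'_1_times[of j x y] E'_1_times[of "d - j" x y] dis.E_times_E[of 1 j x y] j d_ge
      by (simp add: E'_high[OF j] dis.comb_diff dis.comb_add algebra_simps)
  qed (use h d_ge in auto)
  also have "\<dots> = q 1 j h + q 1 (d - j) h - q' 1 j h"
    unfolding res_add using E_times_block_symmetric(2)[of j] j h by (subst res_symmetric) auto
  finally show ?thesis .
qed

lemma vanish1: "j \<le> d \<Longrightarrow> h \<le> d \<Longrightarrow> h > j + 1 \<or> j > h + 1 \<Longrightarrow> q 1 j h = 0"
  using krein_vanish[of 1 j h] d_ge by auto

lemma q'_upper:
  assumes "j \<le> d" "h \<le> d" "h > j + 1"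
  shows "q' 1 j h = 0"
proof -
  consider "2 * j < d" | "2 * j = d" | "2 * (d - j) < d" "d < 2 * j" using assms by linarith
  then show ?thesis
  proof cases
    case 1
    have "q 1 j (d - h) = 0" if "2 * h < d"
      by (rule vanish1) (use assms that in linarith)+
    then show ?thesis using q'_low[OF 1 assms(2)] vanish1[of j h] assms by simp
  next
    case 2
    then show ?thesis using q'_mid[OF 2 assms(2)] vanish1[of j h] assms by simp
  next
    case 3
    \<comment> \<open>As \<open>j\<close> lies above the middle, \<open>h\<close> exceeds
      \<open>d - j\<close> by more than 1 as well.\<close>
    have "q 1 (d - j) h = 0" "q 1 j h = 0" using assms 3 by (intro vanish1; linarith)+
    then show ?thesis using q'_high[OF 3(1) assms(2)] q'_low[OF 3(1) assms(2)] assms 3 by simp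
  qed
qed

text \<open>The factor \<open>t\<close> enters where \<open>j - 1\<close> lies below the middle and
  \<open>j\<close> does not, that is for \<open>j = l\<close>.\<close>

lemma q'_c:
  assumes l: "2 * l = d \<or> 2 * l = d + 1" and j: "1 \<le> j" "j \<le> d"
  shows "q' 1 (j - 1) j = (if j = l then t else 1) * q 1 (j - 1) j"
proof -
  consider "2 * j < d" | "2 * (j - 1) < d" "d \<le> 2 * j" | "2 * (j - 1) = d" | "2 * (d - (j - 1)) < d" "d < 2 * (j - 1)"
    using j by linarith
  then show ?thesis
  proof cases
    case 1
    have "q 1 (j - 1) (d - j) = 0" by (rule vanish1) (use 1 j in linarith)+
    then show ?thesis using q'_low[of "j - 1" j] 1 j l by auto
  next
    case 2
    then have "j = l" using l j by auto
    then show ?thesis using q'_low[of "j - 1" j] 2 j by simp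
  next
    case 3
    then show ?thesis using q'_mid[of "j - 1" j] j l by auto
  next
    case 4
    let ?k = "d - (j - 1)"
    have "q 1 ?k j = 0" by (rule vanish1) (use 4 j in linarith)+
    moreover have "d - ?k = j - 1" using j by simp
    ultimately show ?thesis using q'_high[of ?k j] q'_low[of ?k j] 4 j l by auto
  qed
qed

text \<open>Exchange of indices relates the two parameters through multiplicities, whose ratio is
  \<open>w - 1\<close> by \<open>mult_high\<close>. For even \<open>d\<close>, passing the middle
  uses the reflection symmetry of the coordinates of \<open>E 1\<close> times
  \<open>E l\<close>.\<close>

lemma b_eq_c:
  assumes l: "2 * l = d \<or> 2 * l = d + 1"
  shows "q 1 (d - l + 1) (d - l) = (real w - 1) * q 1 (l - 1) l"
  using l
proof
  assume e: "2 * l = d"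
  then have l1: "d - l = l" "l - 1 \<le> d" "l + 1 \<le> d" "l \<le> d" "1 \<le> d" "d - (l - 1) = l + 1" "2 * (l - 1) < d"
    using d_ge by auto
  have "mult l * q 1 (l + 1) l = mult (l + 1) * q 1 l (l + 1)"
    using krein_rotate[of 1 "l + 1" l] l1 by simp
  also have "q 1 l (l + 1) = q 1 l (l - 1)"
    using E_times_block_symmetric(1)[of l "l - 1"] l1 e by simp
  also have "mult (l + 1) = (real w - 1) * mult (l - 1)" using mult_high[of "l - 1"] l1 by simp
  also have "(real w - 1) * mult (l - 1) * q 1 l (l - 1) = (real w - 1) * (mult l * q 1 (l - 1) l)"
    using krein_rotate[of 1 "l - 1" l] l1 by simp
  finally have "mult l * q 1 (l + 1) l = mult l * ((real w - 1) * q 1 (l - 1) l)" by simp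
  then show ?thesis using mult_pos[of l] l1 by simp
next
  assume e: "2 * l = d + 1"
  then have l1: "d - l = l - 1" "d - (l - 1) = l" "l - 1 + 1 = l" "l \<le> d" "1 \<le> d" "2 * (l - 1) < d"
    using d_ge by auto
  have "mult (l - 1) * q 1 l (l - 1) = mult l * q 1 (l - 1) l"
    using krein_rotate[of 1 l "l - 1"] l1 by simp
  also have "mult l = (real w - 1) * mult (l - 1)" using mult_high[of "l - 1"] l1 by simp
  finally have "mult (l - 1) * q 1 l (l - 1) = mult (l - 1) * ((real w - 1) * q 1 (l - 1) l)" by simp
  then show ?thesis using mult_pos[of "l - 1"] l1 by simp
qed

lemma q'_b:
  assumes l: "2 * l = d \<or> 2 * l = d + 1" and j: "j < d"
  shows "q' 1 (j + 1) j = (if j = d - l then t * ((real w' - 1) / (real w - 1)) else 1) * q 1 (j + 1) j"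
proof -
  have "2 * (d - (j + 1)) < d" if "d < 2 * (j + 1)" using that j by auto
  then consider "2 * (j + 1) < d" | "2 * (j + 1) = d" | "2 * (d - (j + 1)) < d" "d < 2 * (j + 1)"
    by (meson linorder_neqE_nat)
  then show ?thesis
  proof cases
    case 1
    have "q 1 (j + 1) (d - j) = 0" by (rule vanish1) (use 1 j in auto)
    then show ?thesis using q'_low[of "j + 1" j] 1 j l by auto
  next
    case 2
    then show ?thesis using q'_mid[of "j + 1" j] j l by auto
  next
    case 3
    let ?k = "d - (j + 1)"
    have dk: "d - ?k = j + 1" using j by simp
    have eq: "q' 1 (j + 1) j = q 1 ?k j + q 1 (j + 1) j -
        (if 2 * j < d then q 1 ?k j + (t - 1) * q 1 ?k (d - j) else t * q 1 ?k j)"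
      using q'_high[of ?k j] q'_low[of ?k j] 3 j unfolding dk by simp
    show ?thesis
    proof (cases "j = d - l")
      case False
      then have "d < 2 * j" using 3 l by auto
      then have "q 1 ?k j = 0" using j by (intro vanish1) linarith+
      then show ?thesis using eq False \<open>d < 2 * j\<close> by simp
    next
      case True
      \<comment> \<open>For odd \<open>d\<close> the correction comes from the reflected index
        \<open>d - j = l\<close>, for even \<open>d\<close> from \<open>j = l\<close> itself.
        Afterwards \<open>b_eq_c\<close> expresses it through \<open>q 1 (j + 1) j\<close>, which
        turns the sum into a factor.\<close>
      have "q' 1 (j + 1) j = q 1 (j + 1) j + (1 - t) * q 1 (l - 1) l"
      proof (cases "2 * j < d")
        case jd: True
        then have "?k = l - 1" "d - j = l" using l True j by auto
        then show ?thesis using eq jd by (simp add: algebra_simps)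
      next
        case jd: False
        then have "?k = l - 1" "j = l" using l True j by auto
        then show ?thesis using eq jd by (simp add: algebra_simps)
      qed
      moreover have "q 1 (l - 1) l = q 1 (j + 1) j / (real w - 1)"
        using b_eq_c[OF l] True w_ge by simp
      ultimately have "q' 1 (j + 1) j = (1 + (1 - t) / (real w - 1)) * q 1 (j + 1) j"
        by (simp add: algebra_simps diff_divide_distrib)
      moreover have "1 + (1 - t) / (real w - 1) = t * ((real w' - 1) / (real w - 1))"
        using w_ge w'_pos by (simp add: t_def field_simps)
      ultimately show ?thesis using True by simp
    qed
  qed
qed

section \<open>The cometric and Q-antipodal properties of the dismantled scheme\<close>

lemma cometric_dismantled: "cometric Y d \<R>' E'"
proof (rule dis.cometric_criterion)
  have l: "2 * ((d + 1) div 2) = d \<or> 2 * ((d + 1) div 2) = d + 1" by presburger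
  show "q' 1 j (j + 1) > 0" if "j < d" for j
    using q'_c[OF l, of "j + 1"] krein_top_pos[of 1 j] that t_pos by (simp add: add.commute)
qed (use d_ge q'_upper in auto)

lemma E'_0_d: "E' 0 x y + E' d x y = rho (\<lambda>x y. E 0 x y + E d x y) x y"
  using E'_high[of 0] d_ge by (simp add: G_pair)

lemma fibre_rel_dismantled: "fibre_rel Y d E' = fibre_rel X d E \<inter> (Y \<times> Y)"
  using Y_sub by (auto simp: fibre_rel_def E'_0_d rho_def)

lemma Q_antipodal_dismantled: "Q_antipodal Y d \<R>' E'"
  unfolding Q_antipodal_def
proof (intro conjI exI[of _ n] ballI)
  let ?B = "fibre_rel X d E"
  show "equiv Y (fibre_rel Y d E')"
    unfolding fibre_rel_dismantled
  proof (rule equivI)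
    show "refl_on Y (?B \<inter> (Y \<times> Y))"
      using equiv_fibre Y_sub by (auto simp: equiv_def refl_on_def)
    show "sym (?B \<inter> (Y \<times> Y))"
      using equiv_fibre by (intro sym_Int) (auto simp: equiv_def sym_def)
    show "trans (?B \<inter> (Y \<times> Y))"
      using equiv_fibre by (intro trans_Int) (simp add: equiv_def, simp add: trans_def)
  qed auto
  show "card V = n" if "V \<in> fibres Y d E'" for V
  proof -
    obtain x where x: "x \<in> Y" "V = (?B \<inter> (Y \<times> Y)) `` {x}"
      using \<open>V \<in> fibres Y d E'\<close> by (auto simp: fibres_def fibre_rel_dismantled quotient_def)
    \<comment> \<open>\<open>Y\<close> is a union of fibres, so the class of \<open>x\<close> does
      not shrink and keeps its size \<open>n\<close>.\<close>
    have "y \<in> Y" if "(x, y) \<in> ?B" for y using Y_closed[of x y] that x by (simp add: adj_def)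
    then have "V = ?B `` {x}" using x by auto
    then have "V \<in> fibres X d E" using x Y_sub by (auto simp: fibres_def quotient_def)
    then show ?thesis by (rule card_fibre)
  qed
  show "(\<lambda>x y. real n * (E' 0 x y + E' d x y)) = adj (fibre_rel Y d E')"
  proof (intro ext)
    fix x y
    have "real n * (E 0 x y + E d x y) = fib x y" using fun_cong[OF fun_cong[OF fibre_matrix]] .
    then show "real n * (E' 0 x y + E' d x y) = adj (fibre_rel Y d E') x y"
      unfolding E'_0_d fibre_rel_dismantled by (auto simp: rho_def adj_def)
  qed
qed (rule cometric_dismantled)

end

theorem theorem5p7:
  fixes X Y :: "'a set" and \<R> :: "('a \<times> 'a) set set"
    and E :: "nat \<Rightarrow> 'a \<Rightarrow> 'a \<Rightarrow> real"
    and b c :: "nat \<Rightarrow> real" and d w w' l :: nat and \<F> :: "'a set set"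
  assumes "Q_antipodal X d \<R> E"
    and "card (fibres X d E) = w"
    and "krein_array X d E b c"
    and "d \<ge> 3"
    and "l = nat \<lceil>real d / 2\<rceil>"
    and "\<F> \<subseteq> fibres X d E" and "card \<F> = w'" and "w' \<ge> 2" and "Y = \<Union>\<F>"
  shows "\<exists>E' b' c'. Q_antipodal Y d (dismantled \<R> Y) E' \<and> krein_array Y d E' b' c' \<and>
     (\<forall>j\<in>{1..d}. j \<noteq> l \<longrightarrow> c' j = c j) \<and>
     c' l = real w / real w' * c l \<and>
     (\<forall>j\<in>{0..<d}. j \<noteq> d - l \<longrightarrow> b' j = b j) \<and>
     b' (d - l) = real w / real w' * ((real w' - 1) / (real w - 1)) * b (d - l)"
proof -
  from assms(1) obtain n where n: "\<forall>V\<in>fibres X d E. card V = n"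
      "(\<lambda>x y. real n * (E 0 x y + E d x y)) = adj (fibre_rel X d E)"
    and com: "cometric X d \<R> E" and eqv: "equiv X (fibre_rel X d E)"
    by (auto simp: Q_antipodal_def)
  interpret orthogonal_idempotents X \<R> d E
    using com by (intro orthogonal_idempotents_intro) (simp_all add: cometric_def)
  have "finite (fibres X d E)"
    unfolding fibres_def using finite_X eqv by (intro finite_quotient) (auto simp: equiv_def)
  then have "w \<ge> 2" using card_mono[OF _ assms(6)] assms(2,7,8) by linarith
  interpret dismantled_scheme X \<R> d E n w \<F> w' Y
    by unfold_locales (fact com eqv n assms \<open>w \<ge> 2\<close> | use n(1) in blast)+
  \<comment> \<open>The ceiling in integer form: \<open>l\<close> is \<open>d / 2\<close> or
    \<open>(d + 1) / 2\<close> according to parity.\<close>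
  have l: "2 * l = d \<or> 2 * l = d + 1"
  proof -
    have "real l = of_int \<lceil>real d / 2\<rceil>" by (simp add: assms(5))
    then have "real d \<le> 2 * real l" "2 * real l < real d + 2"
      using ceiling_correct[of "real d / 2"] by linarith+
    then show ?thesis by linarith
  qed
  have ld: "1 \<le> l" "l \<le> d" "d - l < d" using l assms(4) by auto
  have b: "b j = q 1 (j + 1) j" if "j < d" for j using assms(3) that by (simp add: krein_array_def)
  have c: "c j = q 1 (j - 1) j" if "1 \<le> j" "j \<le> d" for j using assms(3) that by (simp add: krein_array_def)
  show ?thesis
  proof (intro exI conjI)
    show "Q_antipodal Y d \<R>' E'" by (rule Q_antipodal_dismantled)
    \<comment> \<open>The arrays are taken to be the Krein parameters themselves at every index, so
      this condition holds by definition.\<close>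
    show "krein_array Y d E' (\<lambda>i. q' 1 (i + 1) i) (\<lambda>i. q' 1 (i - 1) i)" by (simp add: krein_array_def)
    show "\<forall>j\<in>{1..d}. j \<noteq> l \<longrightarrow> q' 1 (j - 1) j = c j" using q'_c[OF l] c by simp
    show "q' 1 (l - 1) l = real w / real w' * c l" using q'_c[OF l ld(1,2)] c[OF ld(1,2)] by (simp add: t_def)
    show "\<forall>j\<in>{0..<d}. j \<noteq> d - l \<longrightarrow> q' 1 (j + 1) j = b j" using q'_b[OF l] b by simp
    show "q' 1 (d - l + 1) (d - l) = real w / real w' * ((real w' - 1) / (real w - 1)) * b (d - l)"
      using q'_b[OF l ld(3)] b[OF ld(3)] by (simp add: t_def)
  qed
qed

end
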